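(* Let $d\geq 2$ be a fixed integer, and let $(X_{N(t)})_{t}$ be a well-separated sequence in which, for each $t\in\mathbb{N}$, $X_{N(t)}\subset\mathbb{S}^{d}$ is a spherical $t$-design consisting of $N=N(t)$ points, where $N(t)\asymp t^{d}$. Then: (i) for every fixed $s>d$, the Riesz $s$-energy satisfies $$E_{s}^{(d)}(X_{N})\ll N^{1+\frac{s}{d}};$$ (ii) for $s=d$, $$E_{d}^{(d)}(X_{N})=\frac{1}{2\sqrt{\pi}}\,\frac{\Gamma\left(\frac{d}{2}+\frac12\right)}{\Gamma\left(\frac{d}{2}\right)}\left(\sum_{n=1}^{[t/2]}\frac1n\right)N^{2}+\mathcal{O}(N^{2})\quad\text{as } t\to\infty,$$ and $$\lim_{N\to\infty}\frac{E_{d}^{(d)}(X_{N})}{N^{2}\log N}=\frac{1}{2d\sqrt{\pi}}\,\frac{\Gamma\left(\frac{d}{2}+\frac12\right)}{\Gamma\left(\frac{d}{2}\right)},$$ where the limit is taken along the sequence $N=N(t)$, $t\to\infty$.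
   Context: $\mathbb{S}^{d}=\{\mathbf{x}\in\mathbb{R}^{d+1}:|\mathbf{x}|=1\}$ is the unit sphere, $|\cdot|$ is the Euclidean norm on $\mathbb{R}^{d+1}$, and $\sigma_{d}$ is the Lebesgue surface measure on $\mathbb{S}^{d}$ normalized by $\sigma_{d}(\mathbb{S}^{d})=1$. A spherical $t$-design is a finite set $X_N\subset\mathbb{S}^{d}$ of cardinality $N$ such that $\frac1N\sum_{\mathbf{x}\in X_N}p(\mathbf{x})=\int_{\mathbb{S}^{d}}p(\mathbf{x})\,d\sigma_{d}(\mathbf{x})$ for every spherical polynomial $p$ (restriction to $\mathbb{S}^d$ of a polynomial in $d+1$ real variables) of total degree at most $t$. A sequence of $N$-point sets $X_{N}=\{\mathbf{x}_{1},\ldots,\mathbf{x}_{N}\}\subset\mathbb{S}^d$ is called well-separated if there is a constant $c_{1}>0$ (the same for all sets in the sequence) such that $\min_{i\neq j}|\mathbf{x}_{i}-\mathbf{x}_{j}|>c_{1}N^{-1/d}$ for every set in the sequence. For $s>0$, the discrete Riesz $s$-energy of an $N$-point set $X_N=\{\mathbf{x}_1,\ldots,\mathbf{x}_N\}$ of distinct points is $E_{s}^{(d)}(X_{N})=\frac12\sum_{i,j=1,\ i\neq j}^{N}|\mathbf{x}_{i}-\mathbf{x}_{j}|^{-s}$ (note the factor $\frac12$; the sum is over ordered pairs). The notation $a_{t}\asymp b_{t}$ means that there exist constants $C_{1},C_{2}>0$ independent of $t$ with $C_{1}a_{t}\leq b_{t}\leq C_{2}a_{t}$ for all $t$; $a_{t}\ll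 b_{t}$ means that there is a constant $C>0$ independent of $t$ with $a_{t}\leq C b_{t}$ for all $t$. The constant implied by $\mathcal{O}(N^2)$ is independent of $t$ (and $N$). $[x]$ denotes the integer part of $x$, and $\Gamma$ is the gamma function. *)

theory Defs
  imports "HOL-Analysis.Analysis"
begin

text \<open>
  The surface measure of the unit sphere, via polar coordinates: a Borel set \<open>A\<close> of the sphere has
  surface measure \<open>DIM('a)\<close> times the Lebesgue measure of the cone
  \<open>{r *\<^sub>R x | 0 < r < 1, x \<in> A}\<close>; the factor is \<open>1 / \<integral>\<^sub>0\<^sup>1 r ^ (DIM('a) - 1) dr\<close>.
  The cone over \<open>A\<close> is the preimage of \<open>A\<close> under \<open>sgn x = x /\<^sub>R norm x\<close> on the punctured ball;
  see \<open>emeasure_surface_measure\<close> below.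
\<close>

definition surface_measure :: "'a::euclidean_space measure" where
  "surface_measure = scale_measure (of_nat DIM('a))
     (distr (restrict_space lborel (ball 0 1 - {0})) (restrict_space borel (sphere 0 1)) sgn)"

definition normalized_surface_measure :: "'a::euclidean_space measure" where
  "normalized_surface_measure = uniform_measure surface_measure (sphere 0 1)"

text \<open>
  Spherical polynomials are restrictions to the sphere, so the values of \<open>p\<close> off the
  sphere play no role. The multi-indices \<open>\<alpha>\<close> with \<open>|\<alpha>| \<le> t\<close> form a finite set
  (\<open>finite_multi_indices\<close>).
\<close>

definition spherical_polynomial :: "nat \<Rightarrow> (real ^ 'n \<Rightarrow> real) \<Rightarrow> bool" where
  "spherical_polynomial t p \<longleftrightarrow>
     (\<exists>c :: ('n \<Rightarrow> nat) \<Rightarrow> real. \<forall>x \<in> sphere 0 1.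
        p x = (\<Sum>\<alpha> | (\<Sum>i\<in>UNIV. \<alpha> i) \<le> t. c \<alpha> * (\<Prod>i\<in>UNIV. (x $ i) ^ \<alpha> i)))"

definition spherical_design :: "nat \<Rightarrow> (real ^ 'n) set \<Rightarrow> bool" where
  "spherical_design t X \<longleftrightarrow> finite X \<and> X \<subseteq> sphere 0 1 \<and>
     (\<forall>p. spherical_polynomial t p \<longrightarrow>
        1 / real (card X) * (\<Sum>x\<in>X. p x) = (\<integral>x. p x \<partial>normalized_surface_measure))"

definition riesz_energy :: "real \<Rightarrow> 'a::real_normed_vector set \<Rightarrow> real" where
  "riesz_energy s X = 1 / 2 * (\<Sum>x\<in>X. \<Sum>y\<in>X - {x}. norm (x - y) powr (- s))"

text \<open>
  Sequences indexed by \<open>t\<close> range over the positive integers; the value of a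
  sequence at \<open>0\<close> is irrelevant in the following three definitions.
\<close>

definition well_separated :: "nat \<Rightarrow> (nat \<Rightarrow> 'a::real_normed_vector set) \<Rightarrow> bool" where
  "well_separated d X \<longleftrightarrow>
     (\<exists>c\<^sub>1>0. \<forall>t\<ge>1. \<forall>x\<in>X t. \<forall>y\<in>X t. x \<noteq> y \<longrightarrow>
        norm (x - y) > c\<^sub>1 * real (card (X t)) powr (- 1 / real d))"

definition same_order :: "(nat \<Rightarrow> real) \<Rightarrow> (nat \<Rightarrow> real) \<Rightarrow> bool"  (infix "\<asymp>" 50) where
  "a \<asymp> b \<longleftrightarrow> (\<exists>C\<^sub>1>0. \<exists>C\<^sub>2>0. \<forall>t\<ge>1. C\<^sub>1 * a t \<le> b t \<and> b t \<le> C\<^sub>2 * a t)"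

definition dominated :: "(nat \<Rightarrow> real) \<Rightarrow> (nat \<Rightarrow> real) \<Rightarrow> bool"  (infix "\<lless>" 50) where
  "a \<lless> b \<longleftrightarrow> (\<exists>C>0. \<forall>t\<ge>1. a t \<le> C * b t)"

lemma finite_multi_indices: "finite {\<alpha> :: 'n::finite \<Rightarrow> nat. (\<Sum>i\<in>UNIV. \<alpha> i) \<le> t}"
proof (rule finite_subset)
  show "{\<alpha> :: 'n \<Rightarrow> nat. (\<Sum>i\<in>UNIV. \<alpha> i) \<le> t} \<subseteq> UNIV \<rightarrow>\<^sub>E {..t}"
  proof
    fix \<alpha> :: "'n \<Rightarrow> nat" assume "\<alpha> \<in> {\<alpha>. (\<Sum>i\<in>UNIV. \<alpha> i) \<le> t}"
    moreover have "\<alpha> i \<le> (\<Sum>i\<in>UNIV. \<alpha> i)" for i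
      by (rule member_le_sum) auto
    ultimately have "\<alpha> i \<le> t" for i
      using order.trans by blast
    then show "\<alpha> \<in> UNIV \<rightarrow>\<^sub>E {..t}"
      by (simp add: PiE_iff)
  qed
  show "finite ((UNIV :: 'n set) \<rightarrow>\<^sub>E {..t})"
    by (intro finite_PiE) auto
qed

lemma measurable_sgn_sphere:
  "sgn \<in> measurable (restrict_space lborel (ball 0 1 - {0 :: 'a::euclidean_space}))
     (restrict_space borel (sphere 0 1))"
proof (rule measurable_restrict_space2)
  show "sgn \<in> space (restrict_space lborel (ball 0 1 - {0 :: 'a})) \<rightarrow> sphere 0 1"
    by (auto simp: norm_sgn space_restrict_space)
  show "sgn \<in> borel_measurable (restrict_space lborel (ball 0 1 - {0 :: 'a}))"
    by (rule measurable_restrict_space1) simp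
qed

lemma space_surface_measure [simp]: "space surface_measure = sphere 0 1"
  by (simp add: surface_measure_def space_scale_measure space_restrict_space)

lemma sets_surface_measure [simp, measurable_cong]:
  "sets surface_measure = sets (restrict_space borel (sphere 0 1))"
  by (simp add: surface_measure_def)

lemma emeasure_surface_measure:
  assumes "A \<in> sets (restrict_space borel (sphere (0 :: 'a::euclidean_space) 1))"
  shows "emeasure surface_measure A =
    of_nat DIM('a) * emeasure lborel {r *\<^sub>R x | r x. 0 < r \<and> r < 1 \<and> x \<in> A}"
proof -
  have A: "A \<subseteq> sphere 0 1"
    using sets.sets_into_space[OF assms] by (simp add: space_restrict_space)
  have "sgn -` A \<inter> (ball 0 1 - {0}) = {r *\<^sub>R x | r x. 0 < r \<and> r < 1 \<and> x \<in> A}"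
  proof safe
    fix x :: 'a assume "sgn x \<in> A" "x \<in> ball 0 1" "x \<noteq> 0"
    then show "\<exists>r y. x = r *\<^sub>R y \<and> 0 < r \<and> r < 1 \<and> y \<in> A"
      by (intro exI[of _ "norm x"] exI[of _ "sgn x"]) (auto simp: sgn_div_norm)
  qed (use A in \<open>auto simp: sgn_div_norm\<close>)
  moreover have "emeasure (restrict_space lborel (ball 0 1 - {0 :: 'a})) B = emeasure lborel B"
    if "B \<subseteq> ball 0 1 - {0}" for B
    using that by (intro emeasure_restrict_space) auto
  ultimately show ?thesis
    unfolding surface_measure_def
    by (simp add: emeasure_distr[OF measurable_sgn_sphere assms] space_restrict_space)
       (metis inf_le2)
qed

lemma emeasure_surface_measure_sphere:
  "emeasure surface_measure (sphere (0 :: 'a::euclidean_space) 1) =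
    of_nat DIM('a) * emeasure lborel (ball (0 :: 'a) 1)"
proof -
  have S: "sphere (0 :: 'a) 1 \<in> sets (restrict_space borel (sphere 0 1))"
    by (simp add: sets_restrict_space_iff)
  have "{r *\<^sub>R x | r x. 0 < r \<and> r < 1 \<and> x \<in> sphere (0 :: 'a) 1} = ball 0 1 - {0}"
  proof safe
    fix x :: 'a assume "x \<in> ball 0 1" "x \<noteq> 0"
    then show "\<exists>r y. x = r *\<^sub>R y \<and> 0 < r \<and> r < 1 \<and> y \<in> sphere 0 1"
      by (intro exI[of _ "norm x"] exI[of _ "sgn x"]) (auto simp: sgn_div_norm)
  qed auto
  moreover have "emeasure lborel (ball 0 1 - {0 :: 'a}) = emeasure lborel (ball (0 :: 'a) 1)"
    by (subst emeasure_Diff) auto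
  ultimately show ?thesis
    using emeasure_surface_measure[OF S] by simp
qed

lemma space_normalized_surface_measure [simp]: "space normalized_surface_measure = sphere 0 1"
  by (simp add: normalized_surface_measure_def)

lemma sets_normalized_surface_measure [simp, measurable_cong]:
  "sets normalized_surface_measure = sets (restrict_space borel (sphere 0 1))"
  by (simp add: normalized_surface_measure_def)

lemma emeasure_normalized_surface_measure_sphere:
  "emeasure normalized_surface_measure (sphere (0 :: 'a::euclidean_space) 1) = 1"
proof -
  have "emeasure lborel (ball (0 :: 'a) 1) \<noteq> 0"
    using content_ball_pos[of 1 "0 :: 'a"] by (auto simp: measure_def)
  moreover have "emeasure lborel (ball (0 :: 'a) 1) \<noteq> \<infinity>"
    using emeasure_lborel_ball_finite[of "0 :: 'a" 1] by simp
  ultimately show ?thesis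
    unfolding normalized_surface_measure_def
    by (intro emeasure_uniform_measure_1)
       (auto simp: emeasure_surface_measure_sphere ennreal_mult_eq_top_iff)
qed

end

theory Submission
  imports Defs "HOL-Real_Asymp.Real_Asymp"
begin

text \<open>
  Write \<open>r = norm (x - y)\<close>. For every \<open>M\<close> there is a polynomial \<open>P\<close> of degree of order \<open>M\<close> in the inner
  product \<open>x \<bullet> y\<close> with \<open>0 \<le> r\<^sup>-\<^sup>d - P \<le> C r\<^sup>-\<^sup>d\<^sup>-\<^sup>1 / M\<close> and \<open>0 \<le> P \<le> C M\<^sup>d\<close>: take the \<open>d\<close>-th power of an approximation to
  \<open>1 / r\<close> obtained by integrating a Fejer kernel. Choose \<open>M\<close> of order \<open>t\<close> so that the degree is at most \<open>t\<close>.
  For a fixed point \<open>x\<close> of the design, the sum of \<open>P\<close> over the design equals \<open>N \<integral> P d\<sigma>\<close>, the diagonal term is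
  \<open>O(t\<^sup>d) = O(N)\<close>, and the error is at most \<open>C / t\<close> times the \<open>(d + 1)\<close>-sum at \<open>x\<close>, which is \<open>O(N)\<close> by separation.
  The integral is \<open>d \<kappa> (1 + 1/2 + \<dots> + 1/m) + O(1)\<close> with \<open>m = [t/2]\<close>, because a cap of radius \<open>\<rho>\<close> has measure
  \<open>\<kappa> \<rho>\<^sup>d + O(\<rho>\<^sup>d\<^sup>+\<^sup>1)\<close>. For \<open>s > d\<close> separation alone bounds the energy: a dyadic shell of radius \<open>2\<^sup>k N\<^sup>-\<^sup>1\<^sup>/\<^sup>d\<close>
  around \<open>x\<close> contains \<open>O(2\<^sup>k\<^sup>d)\<close> points.
\<close>

section \<open>Polynomial approximation of the Riesz kernel\<close>

text \<open>At \<open>s = d\<close> the kernel is not integrable over the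
  \<open>d\<close>-dimensional sphere, so the energy cannot be compared with an integral of the
  kernel itself. Passing to \<open>P\<close> cuts the singularity off at distance about
  \<open>1 / t\<close>, and the harmonic sum measures, on a logarithmic scale, the range of
  distances that remains. At exponent \<open>d\<close> the separation argument bounds every dyadic
  shell by the same amount, which cannot produce a constant; at exponent \<open>d + 1\<close> the
  shells decay geometrically towards large radii, the sum at a point is \<open>O(N t)\<close>, and
  the factor \<open>1 / t\<close> of the approximation error pays exactly for the excess. The
  variable behind all the polynomials is \<open>v = r / 2\<close>, the sine of half the angle
  between \<open>x\<close> and \<open>y\<close>: since \<open>v^2 = (1 - x \<bullet> y) / 2\<close>
  is affine in the inner product, polynomials in \<open>v^2\<close> are what a design can integrate.
  This is why the Fejer kernel is taken at an odd multiple \<open>M = 2 j + 1\<close>, for which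
  \<open>sin (M x) / sin x\<close> is a polynomial in \<open>(sin x)^2\<close>.\<close>

lemma sin_ge_half:
  fixes z :: real
  assumes "0 \<le> z" "z \<le> 1"
  shows "z / 2 \<le> sin z"
proof -
  have "1 / 2 \<le> cos x" if "0 \<le> x" "x \<le> z" for x
    using cos_monotone_0_pi_le[of x "pi / 3"] that assms pi_gt3 by (simp add: cos_60)
  then have "sin 0 - 0 / 2 \<le> sin z - z / 2"
    using assms by (intro DERIV_nonneg_imp_nondecreasing[of 0 z "\<lambda>z. sin z - z / 2"])
      (auto intro!: derivative_eq_intros exI)
  then show ?thesis by simp
qed

text \<open>Chebyshev recurrence: \<open>sin (a + 2 x) = 2 cos (2 x) sin a - sin (a - 2 x)\<close>,
  where \<open>2 cos (2 x) = 2 - 4 (sin x)^2\<close> raises the degree by one. The recurrence looks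
  back two steps, so the induction carries two consecutive multiples.\<close>

lemma sin_odd_multiple_poly:
  "\<exists>G :: real poly. degree G \<le> j \<and>
     (\<forall>x. poly G ((sin x)\<^sup>2) * sin x = sin ((2 * real j + 1) * x))"
proof -
  have "(\<exists>G :: real poly. degree G \<le> j \<and>
      (\<forall>x. poly G ((sin x)\<^sup>2) * sin x = sin ((2 * real j + 1) * x))) \<and>
    (\<exists>G :: real poly. degree G \<le> Suc j \<and>
      (\<forall>x. poly G ((sin x)\<^sup>2) * sin x = sin ((2 * real (Suc j) + 1) * x)))"
  proof (induction j)
    case 0
    have "poly [:3, -4:] ((sin x)\<^sup>2) * sin x = sin (3 * x)" for x :: real
    proof -
      have "sin (3 * x) = sin (2 * x + x)" by simp
      also have "\<dots> = 2 * sin x * (cos x)\<^sup>2 + (1 - 2 * (sin x)\<^sup>2) * sin x"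
        unfolding sin_add by (simp add: sin_double cos_double_sin power2_eq_square)
      also have "\<dots> = (3 - 4 * (sin x)\<^sup>2) * sin x"
        by (simp add: cos_squared_eq algebra_simps)
      finally show ?thesis by (simp add: algebra_simps)
    qed
    then show ?case
      by (intro conjI exI[of _ 1] exI[of _ "[:3, -4:]"]) auto
  next
    case (Suc j)
    then obtain G0 G1 :: "real poly" where
      G: "degree G0 \<le> j" "\<And>x. poly G0 ((sin x)\<^sup>2) * sin x = sin ((2 * real j + 1) * x)"
      "degree G1 \<le> Suc j" "\<And>x. poly G1 ((sin x)\<^sup>2) * sin x = sin ((2 * real (Suc j) + 1) * x)"
      by blast
    define G2 where "G2 = [:2, -4:] * G1 - G0"
    have "degree ([:2, -4:] * G1) \<le> Suc (Suc j)"
      using degree_mult_le[of "[:2, -4:]" G1] G(3) by simp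
    then have deg: "degree G2 \<le> Suc (Suc j)"
      unfolding G2_def using G(1) by (intro degree_diff_le) auto
    have "poly G2 ((sin x)\<^sup>2) * sin x = sin ((2 * real (Suc (Suc j)) + 1) * x)" for x
    proof -
      define a where "a = (2 * real (Suc j) + 1) * x"
      have sa: "sin a = poly G1 ((sin x)\<^sup>2) * sin x"
        using G(4)[of x] by (simp add: a_def)
      have "a - 2 * x = (2 * real j + 1) * x"
        by (simp add: a_def algebra_simps)
      then have sb: "sin (a - 2 * x) = poly G0 ((sin x)\<^sup>2) * sin x"
        using G(2)[of x] by simp
      have "sin (a + 2 * x) = 2 * sin a * cos (2 * x) - sin (a - 2 * x)"
        unfolding sin_add sin_diff by simp
      also have "\<dots> = (2 - 4 * (sin x)\<^sup>2) * sin a - sin (a - 2 * x)"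
        unfolding cos_double_sin by (simp add: algebra_simps)
      also have "\<dots> = poly G2 ((sin x)\<^sup>2) * sin x"
        unfolding sa sb by (simp add: G2_def algebra_simps)
      finally show ?thesis by (simp add: a_def algebra_simps)
    qed
    with deg show ?case using Suc by blast
  qed
  then show ?thesis by blast
qed

text \<open>The Fejer kernel \<open>(sin (M x) / sin x)\<^sup>2\<close> as a polynomial in \<open>(sin x)\<^sup>2\<close>.\<close>

lemma fejer_poly:
  fixes j :: nat
  defines "M \<equiv> 2 * real j + 1"
  obtains K :: "real poly" where "degree K \<le> 2 * j"
    and "\<And>v. 0 \<le> poly K (v\<^sup>2)"
    and "\<And>v. 0 < v \<Longrightarrow> v \<le> 1 \<Longrightarrow> poly K (v\<^sup>2) \<le> M\<^sup>2"
    and "\<And>v. 0 < v \<Longrightarrow> v \<le> 1 \<Longrightarrow> poly K (v\<^sup>2) \<le> 1 / v\<^sup>2"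
    and "\<And>v. 0 < v \<Longrightarrow> v \<le> sin (1 / M) \<Longrightarrow> M\<^sup>2 / 4 \<le> poly K (v\<^sup>2)"
proof -
  obtain G :: "real poly" where G: "degree G \<le> j"
    "\<And>x. poly G ((sin x)\<^sup>2) * sin x = sin (M * x)"
    using sin_odd_multiple_poly[of j] unfolding M_def by blast
  have M1: "M \<ge> 1" by (simp add: M_def)
  have G': "(poly (G\<^sup>2) (v\<^sup>2)) = (sin (M * arcsin v))\<^sup>2 / v\<^sup>2" if "0 < v" "v \<le> 1" for v
    using G(2)[of "arcsin v"] that by (simp add: field_simps flip: power_mult_distrib)
  \<comment> \<open>Near \<open>v = 0\<close> the bound \<open>1 / v^2\<close> is useless; this
    inequality at the multiple \<open>M\<close> supplies the uniform bound
    \<open>M^2\<close>.\<close>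
  have mult_le: "\<bar>sin (real n * x)\<bar> \<le> real n * \<bar>sin x\<bar>" for n :: nat and x :: real
  proof (induction n)
    case (Suc n)
    have "\<bar>sin (real (Suc n) * x)\<bar> = \<bar>sin (real n * x) * cos x + cos (real n * x) * sin x\<bar>"
      by (simp add: distrib_right flip: sin_add) (simp add: add.commute)
    also have "\<dots> \<le> \<bar>sin (real n * x)\<bar> * \<bar>cos x\<bar> + \<bar>cos (real n * x)\<bar> * \<bar>sin x\<bar>"
      by (metis abs_mult abs_triangle_ineq)
    also have "\<dots> \<le> \<bar>sin (real n * x)\<bar> * 1 + 1 * \<bar>sin x\<bar>"
      by (intro add_mono mult_mono) auto
    finally show ?case using Suc by (simp add: algebra_simps)
  qed auto
  show ?thesis
  proof
    show "degree (G\<^sup>2) \<le> 2 * j"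
      using degree_power_le[of G 2] G(1) by simp
    show "0 \<le> poly (G\<^sup>2) (v\<^sup>2)" for v
      by simp
    show "poly (G\<^sup>2) (v\<^sup>2) \<le> 1 / v\<^sup>2" if "0 < v" "v \<le> 1" for v
      using that by (subst G') (auto intro!: divide_right_mono simp: abs_square_le_1)
    show "poly (G\<^sup>2) (v\<^sup>2) \<le> M\<^sup>2" if "0 < v" "v \<le> 1" for v
    proof -
      have "\<bar>sin (M * arcsin v)\<bar> \<le> M * v"
        using mult_le[of "2 * j + 1" "arcsin v"] that by (simp add: M_def add.commute)
      then have "(sin (M * arcsin v))\<^sup>2 \<le> (M * v)\<^sup>2"
        using that M1 by (intro abs_le_square_iff[THEN iffD1]) (auto simp: abs_mult)
      then show ?thesis
        using that by (subst G') (auto simp: field_simps power_mult_distrib)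
    qed
    \<comment> \<open>In this range \<open>M * arcsin v\<close> is at most 1, where the sine is at
      least half its argument; squaring the half gives \<open>1 / 4\<close>.\<close>
    show "M\<^sup>2 / 4 \<le> poly (G\<^sup>2) (v\<^sup>2)" if "0 < v" "v \<le> sin (1 / M)" for v
    proof -
      have v1: "v \<le> 1" using that order_trans sin_le_one by blast
      define x where "x = arcsin v"
      have x: "0 < x" "sin x = v" "x \<le> 1 / M"
      proof -
        show "0 < x" using that v1 arcsin_less_arcsin[of 0 v] by (simp add: x_def)
        show "sin x = v" using that v1 by (simp add: x_def)
        have "1 / M \<le> 1" using M1 by simp
        then have "1 / M \<le> pi / 2" using pi_gt3 by linarith
        moreover have "0 < 1 / M" using M1 by simp
        ultimately have "arcsin (sin (1 / M)) = 1 / M"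
          using pi_gt3 by (intro arcsin_sin) linarith+
        then show "x \<le> 1 / M"
          using that v1 arcsin_le_arcsin[of v "sin (1 / M)"] by (simp add: x_def)
      qed
      have "M * v \<le> M * x"
        using x sin_x_le_x[of x] M1 by (intro mult_left_mono) auto
      moreover have "M * x / 2 \<le> sin (M * x)"
        using x M1 by (intro sin_ge_half) (auto simp: field_simps)
      ultimately have "M * v / 2 \<le> sin (M * x)" by linarith
      then have "(M * v / 2)\<^sup>2 \<le> (sin (M * x))\<^sup>2"
        using that M1 by (intro power_mono) auto
      then show ?thesis
        using that v1 unfolding x_def by (subst G') (auto simp: field_simps power_mult_distrib)
    qed
  qed
qed

text \<open>
  The approximation to \<open>1 / v\<close> is \<open>S v / (A * v)\<close>, where \<open>S\<close> is the primitive of the Fejer kernel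
  vanishing at 0 and \<open>A = S 1\<close>; as \<open>S\<close> is odd, this is a polynomial in \<open>v\<^sup>2\<close>.
\<close>

lemma inverse_approx_poly:
  fixes j :: nat
  defines "M \<equiv> 2 * real j + 1"
  obtains h :: "real poly" where "degree h \<le> 2 * j"
    and "\<And>v. 0 \<le> v \<Longrightarrow> v \<le> 1 \<Longrightarrow> 0 \<le> poly h (v\<^sup>2) \<and> poly h (v\<^sup>2) \<le> 8 * M"
    and "\<And>v. 0 < v \<Longrightarrow> v \<le> 1 \<Longrightarrow> poly h (v\<^sup>2) \<le> 1 / v"
    and "\<And>v. 0 < v \<Longrightarrow> v \<le> 1 \<Longrightarrow> 1 / v - poly h (v\<^sup>2) \<le> 8 / (M * v\<^sup>2)"
proof -
  obtain K :: "real poly" where K: "degree K \<le> 2 * j"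
    "\<And>v. 0 \<le> poly K (v\<^sup>2)"
    "\<And>v. 0 < v \<Longrightarrow> v \<le> 1 \<Longrightarrow> poly K (v\<^sup>2) \<le> M\<^sup>2"
    "\<And>v. 0 < v \<Longrightarrow> v \<le> 1 \<Longrightarrow> poly K (v\<^sup>2) \<le> 1 / v\<^sup>2"
    "\<And>v. 0 < v \<Longrightarrow> v \<le> sin (1 / M) \<Longrightarrow> M\<^sup>2 / 4 \<le> poly K (v\<^sup>2)"
    using fejer_poly[of j] unfolding M_def by blast
  have M1: "M \<ge> 1" by (simp add: M_def)
  \<comment> \<open>Dividing the \<open>i\<close>-th coefficient by \<open>2 i + 1\<close>
    integrates \<open>v^(2 i)\<close> term by term, so \<open>v * H(v^2)\<close> is the primitive of
    \<open>K(v^2)\<close>.\<close>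
  define H where "H = (\<Sum>i\<le>2 * j. monom (coeff K i / real (2 * i + 1)) i)"
  have degH: "degree H \<le> 2 * j"
    unfolding H_def by (intro degree_sum_le) (auto intro: order_trans[OF degree_monom_le])
  define S where "S v = v * poly H (v\<^sup>2)" for v
  have S_alt: "S = (\<lambda>v. \<Sum>i\<le>2 * j. coeff K i / real (2 * i + 1) * v ^ (2 * i + 1))"
    by (rule ext) (auto simp: S_def H_def poly_sum poly_monom sum_distrib_left mult_ac
      simp flip: power_mult intro!: sum.cong)
  have K_alt: "poly K (v\<^sup>2) = (\<Sum>i\<le>2 * j. coeff K i * v ^ (2 * i))" for v
    unfolding poly_altdef power_mult
    using K(1) by (intro sum.mono_neutral_left) (auto simp: coeff_eq_0)
  have DS: "(S has_real_derivative poly K (v\<^sup>2)) (at v)" for v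
    unfolding S_alt K_alt
  proof (rule DERIV_sum)
    show "((\<lambda>v. coeff K i / real (2 * i + 1) * v ^ (2 * i + 1)) has_real_derivative
        coeff K i * v ^ (2 * i)) (at v)" for i
      using DERIV_cmult[OF DERIV_pow[of "2 * i + 1" v], of "coeff K i / real (2 * i + 1)"]
      by (simp del: of_nat_add of_nat_mult of_nat_Suc)
  qed
  \<comment> \<open>\<open>mono\<close> stays away from 0 and so admits functions containing
    \<open>1 / v\<close>. \<open>mono0\<close> starts at 0 but asks for the sign of the derivative
    only in the interior, because the bounds on \<open>K\<close> hold for positive
    \<open>v\<close>.\<close>
  have mono: "f u \<le> f v" if "0 < u" "u \<le> v" "v \<le> 1" 
     "\<And>x. 0 < x \<Longrightarrow> x \<le> 1 \<Longrightarrow> (f has_real_derivative f' x) (at x)"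
     "\<And>x. u \<le> x \<Longrightarrow> x \<le> v \<Longrightarrow> 0 \<le> f' x" for f f' :: "real \<Rightarrow> real" and u v
    using that by (intro DERIV_nonneg_imp_nondecreasing[of u v f]) (auto 4 4 intro: order_trans less_le_trans)
  have mono0: "f 0 \<le> f v" if "0 \<le> v" "v \<le> 1" 
     "\<And>x. (f has_real_derivative f' x) (at x)"
     "\<And>x. 0 < x \<Longrightarrow> x < v \<Longrightarrow> 0 \<le> f' x" for f f' :: "real \<Rightarrow> real" and v
    using that
    by (intro DERIV_nonneg_imp_increasing_open[of 0 v f] DERIV_continuous_on[of _ f f'])
       (auto intro: has_field_derivative_at_within)
  have S0: "S 0 = 0" by (simp add: S_def)
  have DS': "((\<lambda>v. c * v - S v) has_real_derivative c - poly K (v\<^sup>2)) (at v)"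
    "((\<lambda>v. S v - c * v) has_real_derivative poly K (v\<^sup>2) - c) (at v)" for c v
    by (rule DERIV_diff[OF DERIV_cmult_Id DS] DERIV_diff[OF DS DERIV_cmult_Id])+
  have S_le: "S v \<le> M\<^sup>2 * v" if "0 \<le> v" "v \<le> 1" for v
    using mono0[OF that DS'(1)[of "M\<^sup>2"]] that K(3) S0 by auto
  have S_nonneg: "0 \<le> S v" if "0 \<le> v" "v \<le> 1" for v
    using mono0[OF that DS] K(2) that S0 by auto
  have S_mono: "S u \<le> S v" if "0 < u" "u \<le> v" "v \<le> 1" for u v
    using that mono[of u v S] DS K(2) by force
  define A where "A = S 1"
  \<comment> \<open>On \<open>[0, sin (1 / M)]\<close>, an interval of length at least
    \<open>1 / (2 M)\<close>, the kernel is at least \<open>M^2 / 4\<close>; the product is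
    \<open>M / 8\<close>.\<close>
  have A: "A \<ge> M / 8"
  proof -
    have half: "1 / (2 * M) \<le> sin (1 / M)"
      using sin_ge_half[of "1 / M"] M1 by simp
    define w where "w = sin (1 / M)"
    have w: "0 < w" "w \<le> 1" using half M1 by (auto simp: w_def intro: less_le_trans[of _ "1 / (2 * M)"])
    have "M / 8 = M\<^sup>2 / 4 * (1 / (2 * M))" using M1 by (simp add: power2_eq_square)
    also have "\<dots> \<le> M\<^sup>2 / 4 * w" using half unfolding w_def by (intro mult_left_mono) auto
    also have "\<dots> \<le> S w"
      using mono0[OF less_imp_le[OF w(1)] w(2) DS'(2)[of "M\<^sup>2 / 4"]] K(5) S0
      by (auto simp: w_def)
    also have "\<dots> \<le> A" using S_mono w unfolding A_def by simp
    finally show ?thesis .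
  qed
  have A0: "A > 0" using A M1 by linarith
  \<comment> \<open>The integral of the kernel from \<open>v\<close> to 1 is at most that of
    \<open>1 / u^2\<close>, namely \<open>1 / v - 1\<close>. Monotonicity of
    \<open>- (S v + 1 / v)\<close> expresses this without integrals.\<close>
  have S_lower: "A - S v \<le> 1 / v" if "0 < v" "v \<le> 1" for v
  proof -
    have "- (S v + 1 / v) \<le> - (S 1 + 1 / 1)"
      using that K(4)
      by (intro mono[of v 1 "\<lambda>v. - (S v + 1 / v)" "\<lambda>v. 1 / v\<^sup>2 - poly K (v\<^sup>2)"])
         (auto intro!: derivative_eq_intros DS simp: power2_eq_square)
    then show ?thesis unfolding A_def using that by (simp add: field_simps)
  qed
  define h where "h = smult (1 / A) H"
  have h: "poly h (v\<^sup>2) = S v / (A * v)" if "0 < v" for v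
    using that by (simp add: h_def S_def)
  show ?thesis
  proof
    show "degree h \<le> 2 * j" using degH by (simp add: h_def)
    show "poly h (v\<^sup>2) \<le> 1 / v" if "0 < v" "v \<le> 1" for v
      using S_mono[of v 1] that A0 by (simp add: h A_def[symmetric] field_simps)
    show "1 / v - poly h (v\<^sup>2) \<le> 8 / (M * v\<^sup>2)" if "0 < v" "v \<le> 1" for v
    proof -
      have "1 / v - poly h (v\<^sup>2) = (A - S v) / (A * v)"
        using that A0 by (simp add: h field_simps)
      also have "\<dots> \<le> (1 / v) / (A * v)"
        using S_lower[OF that] that A0 by (intro divide_right_mono) auto
      also have "\<dots> = 1 / (A * v\<^sup>2)" by (simp add: power2_eq_square)
      also have "\<dots> \<le> 1 / ((M / 8) * v\<^sup>2)"
        using A M1 that by (intro divide_left_mono mult_right_mono) auto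
      finally show ?thesis by simp
    qed
    have bnd: "0 \<le> poly h (v\<^sup>2) \<and> poly h (v\<^sup>2) \<le> 8 * M" if "0 < v" "v \<le> 1" for v
    proof
      show "0 \<le> poly h (v\<^sup>2)" using S_nonneg[of v] A0 that by (simp add: h)
      have "poly h (v\<^sup>2) \<le> M\<^sup>2 * v / (A * v)"
        unfolding h[OF that(1)] using S_le[of v] that A0 by (intro divide_right_mono) auto
      also have "\<dots> = M\<^sup>2 / A" using that by simp
      also have "\<dots> \<le> M\<^sup>2 / (M / 8)" using A A0 M1 by (intro divide_left_mono) auto
      also have "\<dots> = 8 * M" using M1 by (simp add: power2_eq_square)
      finally show "poly h (v\<^sup>2) \<le> 8 * M" .
    qed
    \<comment> \<open>The quotient \<open>S v / (A * v)\<close> says nothing at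
      \<open>v = 0\<close>, where the diagonal term of the design sum lives. The bounds reach this
      point by continuity of the polynomial.\<close>
    have lim: "((\<lambda>v. poly h (v\<^sup>2)) \<longlongrightarrow> poly h (0\<^sup>2)) (at_right 0)"
      by (intro tendsto_intros)
    have ev: "\<forall>\<^sub>F v in at_right 0. 0 \<le> poly h (v\<^sup>2) \<and> poly h (v\<^sup>2) \<le> 8 * M"
      using eventually_at_right_less[of 0] eventually_at_right_real[of 0 1]
      by (auto elim!: eventually_mono dest: bnd[OF _ less_imp_le])
    have b0: "0 \<le> poly h (0\<^sup>2) \<and> poly h (0\<^sup>2) \<le> 8 * M"
      using tendsto_lowerbound[OF lim] tendsto_upperbound[OF lim] eventually_conj_iff ev
      by (smt (verit) eventually_mono trivial_limit_at_right_real)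
    show "0 \<le> poly h (v\<^sup>2) \<and> poly h (v\<^sup>2) \<le> 8 * M" if "0 \<le> v" "v \<le> 1" for v
      using bnd[of v] b0 that by (cases "v = 0") auto
  qed
qed

lemma power_diff_le:
  fixes a b :: real
  assumes "0 \<le> b" "b \<le> a"
  shows "a ^ d - b ^ d \<le> real d * a ^ (d - 1) * (a - b)"
proof -
  have "a ^ d - b ^ d = (a - b) * (\<Sum>i<d. b ^ (d - Suc i) * a ^ i)"
    by (rule power_diff_sumr2)
  also have "\<dots> \<le> (a - b) * (\<Sum>i<d. a ^ (d - Suc i) * a ^ i)"
    using assms by (intro mult_left_mono sum_mono mult_right_mono power_mono) auto
  also have "(\<Sum>i<d. a ^ (d - Suc i) * a ^ i) = (\<Sum>i<d. a ^ (d - 1))"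
    by (intro sum.cong refl) (auto simp flip: power_add)
  finally show ?thesis by (simp add: mult_ac)
qed

text \<open>With \<open>v = r / 2\<close>, half of the polynomial \<open>h\<close> approximates
  \<open>1 / r\<close> from below with error at most \<open>16 / (M r^2)\<close>. Since both
  quantities are nonnegative, the \<open>d\<close>-th power is still an approximation from below,
  and it multiplies the error by at most \<open>d * (1 / r)^(d - 1)\<close>.\<close>

lemma riesz_kernel_approx_poly:
  fixes j d :: nat
  defines "M \<equiv> 2 * real j + 1"
  assumes d: "d \<ge> 1"
  obtains P :: "real poly" where "degree P \<le> 2 * j * d"
    and "\<And>r. 0 \<le> r \<Longrightarrow> r \<le> 2 \<Longrightarrow> 0 \<le> poly P (r\<^sup>2 / 4) \<and> poly P (r\<^sup>2 / 4) \<le> (4 * M) ^ d"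
    and "\<And>r. 0 < r \<Longrightarrow> r \<le> 2 \<Longrightarrow> poly P (r\<^sup>2 / 4) \<le> (1 / r) ^ d"
    and "\<And>r. 0 < r \<Longrightarrow> r \<le> 2 \<Longrightarrow>
      (1 / r) ^ d - poly P (r\<^sup>2 / 4) \<le> 16 * real d / M * (1 / r) ^ (d + 1)"
proof -
  obtain h :: "real poly" where h: "degree h \<le> 2 * j"
    "\<And>v. 0 \<le> v \<Longrightarrow> v \<le> 1 \<Longrightarrow> 0 \<le> poly h (v\<^sup>2) \<and> poly h (v\<^sup>2) \<le> 8 * M"
    "\<And>v. 0 < v \<Longrightarrow> v \<le> 1 \<Longrightarrow> poly h (v\<^sup>2) \<le> 1 / v"
    "\<And>v. 0 < v \<Longrightarrow> v \<le> 1 \<Longrightarrow> 1 / v - poly h (v\<^sup>2) \<le> 8 / (M * v\<^sup>2)"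
    using inverse_approx_poly[of j] unfolding M_def by blast
  have M1: "M \<ge> 1" by (simp add: M_def)
  define b where "b r = poly h ((r / 2)\<^sup>2) / 2" for r :: real
  have P: "poly ((smult (1 / 2) h) ^ d) (r\<^sup>2 / 4) = b r ^ d" for r
    by (simp add: b_def power_divide)
  have b: "0 \<le> b r" "b r \<le> 4 * M" if "0 \<le> r" "r \<le> 2" for r
    using h(2)[of "r / 2"] that by (auto simp: b_def)
  have b_le: "b r \<le> 1 / r" and b_ge: "1 / r - b r \<le> 16 / M * (1 / r)\<^sup>2" if "0 < r" "r \<le> 2" for r
    using h(3)[of "r / 2"] h(4)[of "r / 2"] that M1 by (auto simp: b_def field_simps power2_eq_square)
  have "degree ((smult (1 / 2) h) ^ d) \<le> degree (smult (1 / 2) h) * d"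
    by (rule degree_power_le)
  also have "\<dots> \<le> 2 * j * d" using h(1) by simp
  finally have deg: "degree ((smult (1 / 2) h) ^ d) \<le> 2 * j * d" .
  show ?thesis
  proof (rule that[OF deg], unfold P)
    show "0 \<le> b r ^ d \<and> b r ^ d \<le> (4 * M) ^ d" if "0 \<le> r" "r \<le> 2" for r
      using b[OF that] by (meson power_mono zero_le_power)
    show "b r ^ d \<le> (1 / r) ^ d" if "0 < r" "r \<le> 2" for r
      using b b_le that by (intro power_mono) auto
    show "(1 / r) ^ d - b r ^ d \<le> 16 * real d / M * (1 / r) ^ (d + 1)" if "0 < r" "r \<le> 2" for r
    proof -
      define a where "a = 1 / r"
      have a: "0 \<le> b r" "b r \<le> a" using b b_le that by (auto simp: a_def)
      have "a ^ d - b r ^ d \<le> real d * a ^ (d - 1) * (a - b r)"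
        using a by (rule power_diff_le)
      also have "\<dots> \<le> real d * a ^ (d - 1) * (16 / M * a\<^sup>2)"
        using b_ge[OF that] order_trans[OF a] by (intro mult_left_mono) (auto simp: a_def)
      also have "\<dots> = 16 * real d / M * (a\<^sup>2 * a ^ (d - 1))"
        by simp
      also have "a\<^sup>2 * a ^ (d - 1) = a ^ (d + 1)"
        using d by (simp flip: power_add)
      finally show ?thesis unfolding a_def .
    qed
  qed
qed

section \<open>Zonal polynomials on the sphere\<close>

lemma spherical_polynomial_cong:
  assumes "spherical_polynomial t p" "\<And>x. x \<in> sphere 0 1 \<Longrightarrow> q x = p x"
  shows "spherical_polynomial t q"
  using assms unfolding spherical_polynomial_def by auto

lemma spherical_polynomial_add:
  assumes "spherical_polynomial t p" "spherical_polynomial t q"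
  shows "spherical_polynomial t (\<lambda>x. p x + q x)"
proof -
  obtain a b where "\<forall>x \<in> sphere 0 1. p x = (\<Sum>\<alpha> | sum \<alpha> UNIV \<le> t. a \<alpha> * (\<Prod>i\<in>UNIV. (x $ i) ^ \<alpha> i))"
    "\<forall>x \<in> sphere 0 1. q x = (\<Sum>\<alpha> | sum \<alpha> UNIV \<le> t. b \<alpha> * (\<Prod>i\<in>UNIV. (x $ i) ^ \<alpha> i))"
    using assms unfolding spherical_polynomial_def by blast
  then show ?thesis
    unfolding spherical_polynomial_def
    by (intro exI[of _ "\<lambda>\<alpha>. a \<alpha> + b \<alpha>"]) (simp add: sum.distrib distrib_right)
qed

lemma spherical_polynomial_cmult:
  assumes "spherical_polynomial t p"
  shows "spherical_polynomial t (\<lambda>x. k * p x)"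
proof -
  obtain a where "\<forall>x \<in> sphere 0 1. p x = (\<Sum>\<alpha> | sum \<alpha> UNIV \<le> t. a \<alpha> * (\<Prod>i\<in>UNIV. (x $ i) ^ \<alpha> i))"
    using assms unfolding spherical_polynomial_def by blast
  then show ?thesis
    unfolding spherical_polynomial_def
    by (intro exI[of _ "\<lambda>\<alpha>. k * a \<alpha>"]) (simp add: sum_distrib_left mult.assoc)
qed

lemma spherical_polynomial_sum:
  assumes "\<And>i. i \<in> I \<Longrightarrow> spherical_polynomial t (f i)"
  shows "spherical_polynomial t (\<lambda>x. \<Sum>i\<in>I. f i x)"
proof -
  have zero: "spherical_polynomial t (\<lambda>x. 0)"
    unfolding spherical_polynomial_def by (intro exI[of _ "\<lambda>_. 0"]) auto
  show ?thesis using assms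
    by (induction I rule: infinite_finite_induct) (auto intro: zero spherical_polynomial_add)
qed

lemma spherical_polynomial_monomial:
  fixes \<alpha> :: "'n::finite \<Rightarrow> nat"
  assumes "sum \<alpha> UNIV \<le> t"
  shows "spherical_polynomial t (\<lambda>x. \<Prod>i\<in>UNIV. (x $ i) ^ \<alpha> i)"
  unfolding spherical_polynomial_def
proof (intro exI ballI)
  fix x :: "real ^ 'n"
  show "(\<Prod>i\<in>UNIV. (x $ i) ^ \<alpha> i) =
    (\<Sum>\<beta> | sum \<beta> UNIV \<le> t. (if \<beta> = \<alpha> then 1 else 0) * (\<Prod>i\<in>UNIV. (x $ i) ^ \<beta> i))"
    using assms
    by (subst sum.remove[OF finite_multi_indices, of \<alpha>]) (auto intro!: sum.neutral)
qed

lemma spherical_polynomial_mono: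
  assumes "spherical_polynomial s p" "s \<le> t"
  shows "spherical_polynomial t p"
proof -
  obtain a where a: "\<forall>x \<in> sphere 0 1. p x = (\<Sum>\<alpha> | sum \<alpha> UNIV \<le> s. a \<alpha> * (\<Prod>i\<in>UNIV. (x $ i) ^ \<alpha> i))"
    using assms unfolding spherical_polynomial_def by blast
  have "spherical_polynomial t (\<lambda>x. \<Sum>\<alpha> | sum \<alpha> UNIV \<le> s. a \<alpha> * (\<Prod>i\<in>UNIV. (x $ i) ^ \<alpha> i))"
    using assms(2)
    by (intro spherical_polynomial_sum spherical_polynomial_cmult spherical_polynomial_monomial) auto
  then show ?thesis
    by (rule spherical_polynomial_cong) (use a in auto)
qed

text \<open>The factor \<open>x $ k\<close> shifts every multi-index by one in position
  \<open>k\<close>. Powers of an inner product are built from this rule one coordinate at a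
  time.\<close>

lemma spherical_polynomial_mult_component:
  assumes "spherical_polynomial t p"
  shows "spherical_polynomial (Suc t) (\<lambda>x. p x * x $ k)"
proof -
  obtain a where a: "\<forall>x \<in> sphere 0 1. p x = (\<Sum>\<alpha> | sum \<alpha> UNIV \<le> t. a \<alpha> * (\<Prod>i\<in>UNIV. (x $ i) ^ \<alpha> i))"
    using assms unfolding spherical_polynomial_def by blast
  define \<alpha>' where "\<alpha>' \<alpha> = \<alpha>(k := Suc (\<alpha> k))" for \<alpha> :: "'a \<Rightarrow> nat"
  have sum': "sum (\<alpha>' \<alpha>) UNIV = Suc (sum \<alpha> UNIV)" for \<alpha>
  proof -
    have "sum (\<alpha>' \<alpha>) (UNIV - {k}) = sum \<alpha> (UNIV - {k})"
      by (intro sum.cong) (auto simp: \<alpha>'_def)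
    then show ?thesis
      using sum.remove[of UNIV k "\<alpha>' \<alpha>"] sum.remove[of UNIV k \<alpha>] by (simp add: \<alpha>'_def)
  qed
  have prod': "(\<Prod>i\<in>UNIV. (x $ i) ^ \<alpha>' \<alpha> i) = (\<Prod>i\<in>UNIV. (x $ i) ^ \<alpha> i) * x $ k"
    for \<alpha> and x :: "real ^ 'a"
  proof -
    have "(\<Prod>i\<in>UNIV - {k}. (x $ i) ^ \<alpha>' \<alpha> i) = (\<Prod>i\<in>UNIV - {k}. (x $ i) ^ \<alpha> i)"
      by (intro prod.cong) (auto simp: \<alpha>'_def)
    then show ?thesis
      using prod.remove[of UNIV k "\<lambda>i. (x $ i) ^ \<alpha>' \<alpha> i"] prod.remove[of UNIV k "\<lambda>i. (x $ i) ^ \<alpha> i"]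
      by (simp add: \<alpha>'_def mult_ac)
  qed
  have "spherical_polynomial (Suc t)
      (\<lambda>x. \<Sum>\<alpha> | sum \<alpha> UNIV \<le> t. a \<alpha> * (\<Prod>i\<in>UNIV. (x $ i) ^ \<alpha>' \<alpha> i))"
    by (intro spherical_polynomial_sum spherical_polynomial_cmult spherical_polynomial_monomial)
      (auto simp: sum')
  then show ?thesis
    by (rule spherical_polynomial_cong) (use a in \<open>auto simp: prod' sum_distrib_right mult.assoc\<close>)
qed

lemma spherical_polynomial_inner_power:
  "spherical_polynomial k (\<lambda>y. (x \<bullet> y) ^ k)"
proof (induction k)
  case 0
  then show ?case
    using spherical_polynomial_monomial[of "\<lambda>_. 0" 0] by simp
next
  case (Suc k)
  have "spherical_polynomial (Suc k) (\<lambda>y. \<Sum>i\<in>UNIV. x $ i * ((x \<bullet> y) ^ k * y $ i))"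
    by (intro spherical_polynomial_sum spherical_polynomial_cmult
        spherical_polynomial_mult_component Suc)
  then show ?case
    by (rule spherical_polynomial_cong)
      (simp add: inner_vec_def sum_distrib_left sum_distrib_right mult_ac)
qed

lemma spherical_polynomial_poly_inner:
  assumes "degree Q \<le> t"
  shows "spherical_polynomial t (\<lambda>y. poly Q (x \<bullet> y))"
  unfolding poly_altdef using assms
  by (intro spherical_polynomial_sum spherical_polynomial_cmult
      spherical_polynomial_mono[OF spherical_polynomial_inner_power]) auto

lemma dist_sphere_inner:
  fixes x y :: "'a::real_inner"
  assumes "norm x = 1" "norm y = 1"
  shows "(norm (x - y))\<^sup>2 = 2 - 2 * (x \<bullet> y)"
  using assms unfolding power2_norm_eq_inner norm_eq_1
  by (simp add: inner_diff inner_commute)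

text \<open>For unit vectors \<open>(norm (x - y))^2 / 4\<close> equals
  \<open>1 / 2 - 1 / 2 * (x \<bullet> y)\<close>, so composing \<open>P\<close> with this affine
  polynomial does not raise the degree. The identity fails off the sphere, hence the passage through
  \<open>spherical_polynomial_cong\<close>.\<close>

lemma spherical_polynomial_poly_dist:
  assumes "degree P \<le> t" "norm x = 1"
  shows "spherical_polynomial t (\<lambda>y. poly P ((norm (x - y))\<^sup>2 / 4))"
proof -
  have "degree (pcompose P [:1 / 2, - 1 / 2:]) \<le> t"
    using assms(1) by (intro order_trans[OF degree_pcompose_le]) auto
  then have "spherical_polynomial t (\<lambda>y. poly (pcompose P [:1 / 2, - 1 / 2:]) (x \<bullet> y))"
    by (rule spherical_polynomial_poly_inner)
  then show ?thesis
  proof (rule spherical_polynomial_cong)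
    fix y assume "y \<in> sphere (0 :: real ^ 'a) 1"
    then have "(norm (x - y))\<^sup>2 / 4 = 1 / 2 - 1 / 2 * (x \<bullet> y)"
      using dist_sphere_inner[of x y] assms(2) by (simp add: field_simps)
    then show "poly P ((norm (x - y))\<^sup>2 / 4) = poly (pcompose P [:1 / 2, - 1 / 2:]) (x \<bullet> y)"
      by (simp only: poly_pcompose) (simp add: mult.commute)
  qed
qed

section \<open>Separated points on the sphere\<close>

text \<open>
  Where \<open>\<bar>y $ i\<bar> \<ge> 1 / n\<close>, with fixed sign, forgetting the \<open>i\<close>-th coordinate distorts distances on the
  sphere by a bounded factor, so a grid in the other \<open>n - 1\<close> coordinates separates the points.
\<close>

lemma card_separated_sphere_le:
  fixes X :: "(real ^ 'n) set"
  defines "n \<equiv> real CARD('n)"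
  assumes X: "finite X" "X \<subseteq> sphere 0 1" and \<delta>: "\<delta> > 0" and \<rho>: "\<rho> \<ge> 0"
    and sep: "\<And>y z. y \<in> X \<Longrightarrow> z \<in> X \<Longrightarrow> y \<noteq> z \<Longrightarrow> norm (y - z) > \<delta>"
  shows "real (card {y \<in> X. norm (x - y) \<le> \<rho>}) \<le>
    2 * n * (2 * n\<^sup>2 * \<rho> / \<delta> + 2) ^ (CARD('n) - 1)"
proof -
  define Y where "Y i s = {y \<in> X. norm (x - y) \<le> \<rho> \<and> 1 / n \<le> s * y $ i}" for i :: 'n and s :: real
  \<comment> \<open>Two points of one grid cell differ by at most \<open>\<eta>\<close> in each of
    \<open>n - 1\<close> coordinates and, as shown below, by at most \<open>n (n - 1) \<eta>\<close>
    in the \<open>i\<close>-th. The total \<open>(n^2 - 1) \<eta>\<close> is below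
    \<open>\<delta>\<close> for this mesh.\<close>
  define \<eta> where "\<eta> = \<delta> / n\<^sup>2"
  have n: "n \<ge> 1" unfolding n_def by (simp add: Suc_leI)
  have \<eta>: "\<eta> > 0" using n \<delta> by (simp add: \<eta>_def)
  have comp: "\<bar>y $ i\<bar> \<le> 1" if "y \<in> X" for y i
    using component_le_norm_cart[of y i] X(2) that by auto
  define B where "B = 2 * n\<^sup>2 * \<rho> / \<delta> + 2"
  have Y_le: "real (card (Y i s)) \<le> B ^ (CARD('n) - 1)" if s: "s \<in> {1, -1}" for i s
  proof -
    define \<phi> where "\<phi> y = (\<lambda>j\<in>UNIV - {i}. \<lfloor>y $ j / \<eta>\<rfloor>)" for y :: "real ^ 'n"
    define J where "J j = {\<lfloor>(x $ j - \<rho>) / \<eta>\<rfloor>..\<lfloor>(x $ j + \<rho>) / \<eta>\<rfloor>}" for j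
    have "inj_on \<phi> (Y i s)"
    proof (rule inj_onI, rule ccontr)
      fix y z assume yz: "y \<in> Y i s" "z \<in> Y i s" "\<phi> y = \<phi> z" "y \<noteq> z"
      then have mem: "y \<in> X" "z \<in> X" by (auto simp: Y_def)
      have close: "\<bar>y $ j - z $ j\<bar> \<le> \<eta>" if "j \<noteq> i" for j
      proof -
        have "\<lfloor>y $ j / \<eta>\<rfloor> = \<lfloor>z $ j / \<eta>\<rfloor>"
          using fun_cong[OF yz(3), of j] that by (simp add: \<phi>_def)
        then have "\<bar>y $ j / \<eta> - z $ j / \<eta>\<bar> \<le> 1" by linarith
        then show ?thesis using \<eta> by (simp add: field_simps flip: diff_divide_distrib)
      qed
      have card_i: "real (card (UNIV - {i})) = n - 1"
        by (simp add: n_def card_Diff_singleton of_nat_diff Suc_leI)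
      have sq: "(\<Sum>j\<in>UNIV. (w $ j)\<^sup>2) = 1" if "w \<in> X" for w
        using X(2) that norm_eq_1[of w] by (auto simp: inner_vec_def power2_eq_square)
      \<comment> \<open>Both points have norm 1, so the squares of the \<open>i\<close>-th
        coordinates differ only by what the other coordinates differ. Dividing by
        \<open>\<bar>y $ i + z $ i\<bar> \<ge> 2 / n\<close> recovers the difference of the
        coordinates.\<close>
      have "(y $ i)\<^sup>2 - (z $ i)\<^sup>2 = (\<Sum>j\<in>UNIV - {i}. (z $ j)\<^sup>2 - (y $ j)\<^sup>2)"
        using sq[OF mem(1)] sq[OF mem(2)] by (simp add: sum_subtractf sum.remove[of UNIV i])
      also have "\<bar>\<dots>\<bar> \<le> (\<Sum>j\<in>UNIV - {i}. 2 * \<eta>)"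
      proof (rule order_trans[OF sum_abs], rule sum_mono)
        fix j assume "j \<in> UNIV - {i}"
        have "\<bar>(z $ j)\<^sup>2 - (y $ j)\<^sup>2\<bar> = \<bar>z $ j + y $ j\<bar> * \<bar>y $ j - z $ j\<bar>"
          by (simp add: power2_eq_square algebra_simps flip: abs_mult)
        also have "\<dots> \<le> 2 * \<eta>"
          using comp[OF mem(1), of j] comp[OF mem(2), of j] close \<open>j \<in> _\<close> \<eta>
          by (intro mult_mono) auto
        finally show "\<bar>(z $ j)\<^sup>2 - (y $ j)\<^sup>2\<bar> \<le> 2 * \<eta>" .
      qed
      also have "\<dots> = (n - 1) * (2 * \<eta>)" by (simp only: sum_constant card_i)
      finally have diff: "\<bar>(y $ i)\<^sup>2 - (z $ i)\<^sup>2\<bar> \<le> (n - 1) * (2 * \<eta>)" .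
      have "2 / n \<le> \<bar>y $ i + z $ i\<bar>"
        using yz(1,2) s by (auto simp: Y_def)
      then have "2 / n * \<bar>y $ i - z $ i\<bar> \<le> \<bar>y $ i + z $ i\<bar> * \<bar>y $ i - z $ i\<bar>"
        by (intro mult_right_mono) auto
      also have "\<dots> = \<bar>(y $ i)\<^sup>2 - (z $ i)\<^sup>2\<bar>"
        by (simp add: power2_eq_square algebra_simps flip: abs_mult)
      also note diff
      finally have "2 * \<bar>y $ i - z $ i\<bar> \<le> (n - 1) * (2 * \<eta>) * n"
        using n by (simp add: field_simps)
      then have yi: "\<bar>y $ i - z $ i\<bar> \<le> n * (n - 1) * \<eta>" by (simp add: algebra_simps)
      have "norm (y - z) \<le> (\<Sum>j\<in>UNIV. \<bar>(y - z) $ j\<bar>)" by (rule norm_le_l1_cart)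
      also have "\<dots> = \<bar>y $ i - z $ i\<bar> + (\<Sum>j\<in>UNIV - {i}. \<bar>y $ j - z $ j\<bar>)"
        by (simp add: sum.remove[of UNIV i])
      also have "(\<Sum>j\<in>UNIV - {i}. \<bar>y $ j - z $ j\<bar>) \<le> (\<Sum>j\<in>UNIV - {i}. \<eta>)"
        using close by (intro sum_mono) auto
      also have "\<dots> = (n - 1) * \<eta>" by (simp only: sum_constant card_i)
      finally have "norm (y - z) \<le> n * (n - 1) * \<eta> + (n - 1) * \<eta>" using yi by linarith
      also have "\<dots> = n\<^sup>2 * \<eta> - \<eta>" by (simp add: algebra_simps power2_eq_square)
      also have "\<dots> \<le> \<delta>" using \<eta> n by (simp add: \<eta>_def)
      finally show False using sep[OF mem yz(4)] by simp
    qed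
    moreover have "\<phi> ` Y i s \<subseteq> PiE (UNIV - {i}) J"
    proof (intro image_subsetI PiE_I)
      fix y j assume y: "y \<in> Y i s" and j: "j \<in> UNIV - {i}"
      have "\<bar>x $ j - y $ j\<bar> \<le> \<rho>"
        using y component_le_norm_cart[of "x - y" j] by (auto simp: Y_def)
      then have "(x $ j - \<rho>) / \<eta> \<le> y $ j / \<eta>" "y $ j / \<eta> \<le> (x $ j + \<rho>) / \<eta>"
        using \<eta> by (auto intro!: divide_right_mono)
      then show "\<phi> y j \<in> J j" using j by (simp add: \<phi>_def J_def floor_mono)
    qed (auto simp: \<phi>_def)
    moreover have "finite (PiE (UNIV - {i}) J)" by (intro finite_PiE) (auto simp: J_def)
    ultimately have "card (Y i s) \<le> card (PiE (UNIV - {i}) J)" by (rule card_inj_on_le)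
    also have "real \<dots> = (\<Prod>j\<in>UNIV - {i}. real (card (J j)))" by (simp add: card_PiE)
    also have "\<dots> \<le> (\<Prod>j\<in>UNIV - {i}. B)"
    proof (intro prod_mono conjI)
      fix j
      \<comment> \<open>An interval of width \<open>w\<close> meets fewer than \<open>w + 2\<close>
        unit cells: one extra from the two floors and one from counting both ends.\<close>
      have "(x $ j + \<rho>) / \<eta> - (x $ j - \<rho>) / \<eta> = 2 * n\<^sup>2 * \<rho> / \<delta>"
        by (simp add: \<eta>_def algebra_simps flip: diff_divide_distrib)
      moreover have "(x $ j - \<rho>) / \<eta> \<le> (x $ j + \<rho>) / \<eta>"
        using \<rho> \<eta> by (intro divide_right_mono) auto
      then have "\<lfloor>(x $ j - \<rho>) / \<eta>\<rfloor> \<le> \<lfloor>(x $ j + \<rho>) / \<eta>\<rfloor>" by (rule floor_mono)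
      then have "real (card (J j)) = of_int \<lfloor>(x $ j + \<rho>) / \<eta>\<rfloor> - of_int \<lfloor>(x $ j - \<rho>) / \<eta>\<rfloor> + 1"
        by (simp add: J_def)
      ultimately show "real (card (J j)) \<le> B" unfolding B_def by linarith
    qed auto
    also have "\<dots> = B ^ (CARD('n) - 1)" by (simp add: card_Diff_singleton)
    finally show ?thesis by simp
  qed
  have "{y \<in> X. norm (x - y) \<le> \<rho>} \<subseteq> (\<Union>(i, s) \<in> UNIV \<times> {1, -1}. Y i s)"
  proof
    fix y assume y: "y \<in> {y \<in> X. norm (x - y) \<le> \<rho>}"
    \<comment> \<open>The sum of the absolute coordinates of a unit vector is at least 1, so some
      coordinate is at least the average \<open>1 / n\<close>. Coordinate and sign together give
      \<open>2 n\<close> classes.\<close>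
    have "\<exists>i. 1 / n \<le> \<bar>y $ i\<bar>"
    proof (rule ccontr)
      assume "\<not> ?thesis"
      then have "(\<Sum>i\<in>UNIV. \<bar>y $ i\<bar>) < (\<Sum>i\<in>(UNIV :: 'n set). 1 / n)"
        by (intro sum_strict_mono) (auto simp: not_le)
      also have "\<dots> = 1" by (simp add: n_def)
      finally show False using norm_le_l1_cart[of y] y X(2) by auto
    qed
    then obtain i where "1 / n \<le> \<bar>y $ i\<bar>" by blast
    then have "y \<in> Y i 1 \<or> y \<in> Y i (-1)" using y by (auto simp: Y_def abs_if split: if_splits)
    then show "y \<in> (\<Union>(i, s) \<in> UNIV \<times> {1, -1}. Y i s)" by auto
  qed
  then have "card {y \<in> X. norm (x - y) \<le> \<rho>} \<le> card (\<Union>(i, s) \<in> UNIV \<times> {1, -1}. Y i s)"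
    using X(1) by (intro card_mono) (auto simp: Y_def)
  also have "\<dots> \<le> (\<Sum>(i, s) \<in> UNIV \<times> {1, -1}. card (Y i s))"
    using card_UN_le[of "UNIV \<times> {1, -1}" "\<lambda>(i, s). Y i s"] by (simp add: case_prod_unfold)
  finally have "real (card {y \<in> X. norm (x - y) \<le> \<rho>}) \<le>
      real (\<Sum>(i, s) \<in> UNIV \<times> {1, -1}. card (Y i s))" by (simp only: of_nat_le_iff)
  also have "\<dots> = (\<Sum>(i, s) \<in> (UNIV :: 'n set) \<times> {1, -1}. real (card (Y i s)))"
    by (simp add: case_prod_unfold)
  also have "\<dots> \<le> (\<Sum>(i, s) \<in> (UNIV :: 'n set) \<times> {1, -1 :: real}. B ^ (CARD('n) - 1))"
    using Y_le by (intro sum_mono) auto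
  also have "\<dots> = 2 * n * B ^ (CARD('n) - 1)"
    by (simp add: case_prod_unfold card_cartesian_product n_def)
  finally show ?thesis unfolding B_def .
qed

lemma ex_dyadic_scale:
  fixes r \<delta> :: real
  assumes "0 < \<delta>" "\<delta> \<le> r" "r < 2 ^ K * \<delta>"
  shows "\<exists>k<K. 2 ^ k * \<delta> \<le> r \<and> r < 2 ^ Suc k * \<delta>"
  using assms(3)
proof (induction K)
  case (Suc K)
  then show ?case by (cases "r < 2 ^ K * \<delta>") (auto intro: less_SucI)
qed (use assms in auto)

text \<open>The shell at distance \<open>2^k \<delta>\<close> contributes at most \<open>C0 * 2^(k
  d) * (2^k \<delta>)^(-s) = C0 * \<delta>^(-s) * q^k\<close>, and \<open>q < 1\<close> says exactly
  that \<open>s > d\<close>. The number of points does not enter; the constant depends only on the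
  dimension and \<open>s\<close>.\<close>

lemma riesz_sum_separated_le:
  assumes "CARD('n::finite) = d + 1" "real d < s"
  obtains C where "C > 0"
    "\<And>(X :: (real ^ 'n) set) \<delta> x. finite X \<Longrightarrow> X \<subseteq> sphere 0 1 \<Longrightarrow> \<delta> > 0 \<Longrightarrow> x \<in> X \<Longrightarrow>
      (\<And>y z. y \<in> X \<Longrightarrow> z \<in> X \<Longrightarrow> y \<noteq> z \<Longrightarrow> norm (y - z) > \<delta>) \<Longrightarrow>
      (\<Sum>y\<in>X - {x}. norm (x - y) powr (- s)) \<le> C * \<delta> powr (- s)"
proof -
  define n where "n = real CARD('n)"
  have n: "n \<ge> 1" unfolding n_def by (simp add: Suc_leI)
  define C0 where "C0 = 2 * n * (8 * n\<^sup>2) ^ d"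
  define q where "q = (2 :: real) powr (real d - s)"
  have q: "0 < q" "q < 1" using assms(2) by (auto simp: q_def powr_less_one)
  have C0: "C0 > 0" using n by (simp add: C0_def)
  show ?thesis
  proof (rule that[of "C0 * (1 / (1 - q))"])
    show "0 < C0 * (1 / (1 - q))" using C0 q by simp
  next
    fix X :: "(real ^ 'n) set" and \<delta> :: real and x :: "real ^ 'n"
    assume X: "finite X" "X \<subseteq> sphere 0 1" and \<delta>: "\<delta> > 0" and x: "x \<in> X"
      and sep: "\<And>y z. y \<in> X \<Longrightarrow> z \<in> X \<Longrightarrow> y \<noteq> z \<Longrightarrow> norm (y - z) > \<delta>"
    \<comment> \<open>Points of the sphere are at distance at most 2, so \<open>K\<close> shells
      reach all of them.\<close>
    obtain K where "2 / \<delta> < 2 ^ K" using real_arch_pow[of 2 "2 / \<delta>"] by auto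
    then have K: "2 < 2 ^ K * \<delta>" using \<delta> by (simp add: field_simps)
    \<comment> \<open>Each shell is enlarged to the ball of its outer radius. The additional terms
      are nonnegative, and balls are what \<open>card_separated_sphere_le\<close> counts.\<close>
    have pt: "norm (x - y) powr (- s) \<le>
        (\<Sum>k<K. (2 ^ k * \<delta>) powr (- s) * (if norm (x - y) \<le> 2 ^ Suc k * \<delta> then 1 else 0))"
      if y: "y \<in> X - {x}" for y
    proof -
      have "\<delta> \<le> norm (x - y)" using sep[of x y] x y by auto
      moreover have "norm (x - y) \<le> 2"
        using norm_triangle_ineq4[of x y] subsetD[OF X(2) x] subsetD[OF X(2), of y] y by simp
      ultimately obtain k where k: "k < K" "2 ^ k * \<delta> \<le> norm (x - y)" "norm (x - y) < 2 ^ Suc k * \<delta>"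
        using ex_dyadic_scale[of \<delta> "norm (x - y)" K] \<delta> K by auto
      have "norm (x - y) powr (- s) \<le> (2 ^ k * \<delta>) powr (- s)"
        using k(2) \<delta> assms(2) by (intro powr_mono2') auto
      also have "\<dots> = (2 ^ k * \<delta>) powr (- s) * (if norm (x - y) \<le> 2 ^ Suc k * \<delta> then 1 else 0)"
        using k(3) by simp
      also have "\<dots> \<le> (\<Sum>k<K. (2 ^ k * \<delta>) powr (- s) * (if norm (x - y) \<le> 2 ^ Suc k * \<delta> then 1 else 0))"
        using k(1) by (intro member_le_sum) auto
      finally show ?thesis .
    qed
    have card_le: "real (card {y \<in> X - {x}. norm (x - y) \<le> 2 ^ Suc k * \<delta>}) \<le> C0 * (2 ^ k) ^ d" for k
    proof -
      have "card {y \<in> X - {x}. norm (x - y) \<le> 2 ^ Suc k * \<delta>} \<le> card {y \<in> X. norm (x - y) \<le> 2 ^ Suc k * \<delta>}"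
        using X(1) by (intro card_mono) auto
      also have "real \<dots> \<le> 2 * n * (2 * n\<^sup>2 * (2 ^ Suc k * \<delta>) / \<delta> + 2) ^ (CARD('n) - 1)"
        unfolding n_def using X \<delta> sep by (intro card_separated_sphere_le) auto
      also have "\<dots> = 2 * n * (4 * n\<^sup>2 * 2 ^ k + 2) ^ d"
        using \<delta> assms(1) by (simp add: mult.assoc)
      also have "\<dots> \<le> 2 * n * (8 * n\<^sup>2 * 2 ^ k) ^ d"
      proof -
        have "1 * 1 \<le> n\<^sup>2 * (2 ^ k :: real)" using n by (intro mult_mono) auto
        then show ?thesis using n by (intro mult_left_mono power_mono) auto
      qed
      also have "\<dots> = C0 * (2 ^ k) ^ d" by (simp add: C0_def power_mult_distrib)
      finally show ?thesis by simp
    qed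
    have "(\<Sum>y\<in>X - {x}. norm (x - y) powr (- s)) \<le>
        (\<Sum>y\<in>X - {x}. \<Sum>k<K. (2 ^ k * \<delta>) powr (- s) * (if norm (x - y) \<le> 2 ^ Suc k * \<delta> then 1 else 0))"
      using pt by (rule sum_mono)
    also have "\<dots> = (\<Sum>k<K. \<Sum>y\<in>X - {x}. (2 ^ k * \<delta>) powr (- s) * (if norm (x - y) \<le> 2 ^ Suc k * \<delta> then 1 else 0))"
      by (rule sum.swap)
    also have "\<dots> = (\<Sum>k<K. (2 ^ k * \<delta>) powr (- s) * real (card {y \<in> X - {x}. norm (x - y) \<le> 2 ^ Suc k * \<delta>}))"
      using X(1) by (intro sum.cong refl) (simp add: sum.If_cases Int_def flip: sum_distrib_left)
    also have "\<dots> \<le> (\<Sum>k<K. (2 ^ k * \<delta>) powr (- s) * (C0 * (2 ^ k) ^ d))"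
      by (intro sum_mono mult_left_mono card_le) auto
    also have "\<dots> = (\<Sum>k<K. C0 * \<delta> powr (- s) * q ^ k)"
    proof (intro sum.cong refl)
      fix k
      have "q ^ k = (2 ^ k) powr (real d - s)"
        by (simp add: q_def powr_powr mult.commute flip: powr_realpow)
      also have "\<dots> = (2 ^ k) powr (- s) * (2 ^ k) ^ d"
        by (simp add: powr_diff powr_minus powr_realpow field_simps)
      finally show "(2 ^ k * \<delta>) powr (- s) * (C0 * (2 ^ k) ^ d) = C0 * \<delta> powr (- s) * q ^ k"
        using \<delta> by (simp add: powr_mult)
    qed
    also have "\<dots> = C0 * \<delta> powr (- s) * (\<Sum>k<K. q ^ k)" by (simp add: sum_distrib_left)
    also have "\<dots> \<le> C0 * \<delta> powr (- s) * (1 / (1 - q))"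
      using q C0 by (intro mult_left_mono, subst sum_gp_strict) (auto intro!: divide_right_mono)
    finally show "(\<Sum>y\<in>X - {x}. norm (x - y) powr (- s)) \<le> C0 * (1 / (1 - q)) * \<delta> powr (- s)"
      by (simp only: mult_ac)
  qed
qed

section \<open>Measure of spherical caps\<close>

lemma nn_integral_lborel_shift:
  fixes f :: "'a::euclidean_space \<Rightarrow> ennreal"
  assumes [measurable]: "f \<in> borel_measurable borel"
  shows "(\<integral>\<^sup>+x. f (c + x) \<partial>lborel) = (\<integral>\<^sup>+x. f x \<partial>lborel)"
proof -
  have "(\<integral>\<^sup>+x. f x \<partial>lborel) = (\<integral>\<^sup>+x. f x \<partial>(distr lborel borel ((+) c)))"
    by (simp add: lborel_distr_plus)
  also have "\<dots> = (\<integral>\<^sup>+x. f (c + x) \<partial>lborel)"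
    by (subst nn_integral_distr) auto
  finally show ?thesis ..
qed

text \<open>
  The library has rotation invariance only over well-ordered index types. Here it follows from
  translation invariance: with \<open>B\<close> the unit ball, evaluate
  \<open>\<integral>\<integral> 1\<^sub>A(T x + y) 1\<^sub>B(y) dx dy\<close> in both orders.
\<close>

lemma emeasure_lborel_orthogonal_vimage:
  fixes T :: "'a::euclidean_space \<Rightarrow> 'a"
  assumes T: "orthogonal_transformation T" and A [measurable]: "A \<in> sets borel"
  shows "emeasure lborel (T -` A) = emeasure lborel A"
proof -
  define B where "B = ball (0 :: 'a) 1"
  have [measurable]: "B \<in> sets borel" by (simp add: B_def)
  have lin: "linear T" using T by (rule orthogonal_transformation_linear)
  have [measurable]: "T \<in> borel_measurable borel"
    using lin by (intro borel_measurable_continuous_onI linear_continuous_on) (simp add: linear_conv_bounded_linear)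
  have surj: "\<exists>x. T x = y" for y
    using orthogonal_transformation_surj[OF T] by (metis surjD)
  have TA: "T -` A \<in> sets borel" using measurable_sets[of T borel borel A] by simp
  have "emeasure lborel (T -` A) * emeasure lborel B =
      (\<integral>\<^sup>+y. (\<integral>\<^sup>+x. indicator A (T x) \<partial>lborel) * indicator B y \<partial>lborel)"
    using TA by (simp add: nn_integral_cmult flip: indicator_vimage)
  also have "\<dots> = (\<integral>\<^sup>+y. (\<integral>\<^sup>+x. indicator A (T x + y) * indicator B y \<partial>lborel) \<partial>lborel)"
  proof (intro nn_integral_cong)
    fix y
    obtain w where w: "T w = y" using surj by blast
    have "(\<integral>\<^sup>+x. indicator A (T x) \<partial>lborel) = (\<integral>\<^sup>+x. indicator A (T (w + x)) \<partial>lborel)"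
      by (rule nn_integral_lborel_shift[symmetric]) simp
    then show "(\<integral>\<^sup>+x. indicator A (T x) \<partial>lborel) * indicator B y =
        (\<integral>\<^sup>+x. indicator A (T x + y) * indicator B y \<partial>lborel)"
      by (simp add: nn_integral_multc linear_add[OF lin] w add.commute)
  qed
  also have "\<dots> = (\<integral>\<^sup>+x. (\<integral>\<^sup>+y. indicator A (T x + y) * indicator B y \<partial>lborel) \<partial>lborel)"
    by (rule lborel_pair.Fubini') simp
  also have "\<dots> = (\<integral>\<^sup>+x. (\<integral>\<^sup>+y. indicator A y * indicator B (y - T x) \<partial>lborel) \<partial>lborel)"
  proof (rule nn_integral_cong)
    fix x
    have "(\<integral>\<^sup>+y. indicator A (T x + y) * indicator B ((T x + y) - T x) \<partial>lborel) =
        (\<integral>\<^sup>+y. indicator A y * indicator B (y - T x) \<partial>lborel)"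
      by (rule nn_integral_lborel_shift[of "\<lambda>y. indicator A y * indicator B (y - T x)" "T x"]) simp
    then show "(\<integral>\<^sup>+y. indicator A (T x + y) * indicator B y \<partial>lborel) =
        (\<integral>\<^sup>+y. indicator A y * indicator B (y - T x) \<partial>lborel)" by simp
  qed
  also have "\<dots> = (\<integral>\<^sup>+y. (\<integral>\<^sup>+x. indicator A y * indicator B (y - T x) \<partial>lborel) \<partial>lborel)"
    by (rule lborel_pair.Fubini') simp
  also have "\<dots> = (\<integral>\<^sup>+y. indicator A y * emeasure lborel B \<partial>lborel)"
  proof (intro nn_integral_cong)
    fix y
    obtain w where w: "T w = y" using surj by blast
    \<comment> \<open>Norm preservation enters here: as a function of \<open>x\<close> this is the
      indicator of the unit ball about a preimage \<open>w\<close> of \<open>y\<close>, and its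
      volume does not depend on \<open>y\<close>.\<close>
    have "indicator B (y - T x) = (indicator (ball w 1) x :: ennreal)" for x
    proof -
      have "norm (y - T x) = norm (w - x)"
        using orthogonal_transformation_norm[OF T, of "w - x"] by (simp add: w linear_diff[OF lin])
      then show ?thesis by (simp add: B_def indicator_def dist_norm norm_minus_commute)
    qed
    then show "(\<integral>\<^sup>+x. indicator A y * indicator B (y - T x) \<partial>lborel) = indicator A y * emeasure lborel B"
      by (simp only:) (subst nn_integral_cmult, simp_all add: B_def emeasure_ball borel_measurable_indicator)
  qed
  also have "\<dots> = emeasure lborel A * emeasure lborel B"
    by (simp add: nn_integral_multc)
  finally have "emeasure lborel (T -` A) * emeasure lborel B = emeasure lborel A * emeasure lborel B" .
  moreover have "emeasure lborel B = ennreal (unit_ball_vol DIM('a))"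
    by (simp add: B_def emeasure_ball)
  moreover have "ennreal (unit_ball_vol DIM('a)) \<noteq> 0" "ennreal (unit_ball_vol DIM('a)) \<noteq> top"
    using unit_ball_vol_pos[of "DIM('a)"] by (auto simp: ennreal_eq_0_iff not_le)
  ultimately show ?thesis
    by (metis ennreal_mult_divide_eq)
qed

text \<open>Splitting off the coordinate along \<open>b\<close>, the slice at height
  \<open>y\<close> is a \<open>d\<close>-dimensional ball of radius \<open>\<tau> * y\<close>, and
  its volume is integrated over the height.\<close>

lemma emeasure_straight_cone:
  fixes b :: "'a::euclidean_space"
  assumes b: "b \<in> Basis" and dim: "DIM('a) = d + 1" and \<tau>: "\<tau> > 0" and h: "h > 0"
  shows "emeasure lborel {z :: 'a. 0 < z \<bullet> b \<and> z \<bullet> b < h \<and>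
      sqrt (\<Sum>i\<in>Basis - {b}. (z \<bullet> i)\<^sup>2) \<le> \<tau> * (z \<bullet> b)} =
    ennreal (unit_ball_vol d * \<tau> ^ d * h ^ (d + 1) / (d + 1))"
proof -
  interpret product_sigma_finite "\<lambda>_. lborel"
    by standard
  define I where "I = Basis - {b}"
  have I: "finite I" "b \<notin> I" "insert b I = Basis" "card I = d"
    using b dim by (auto simp: I_def card_Diff_singleton)
  define S where "S = {f :: 'a \<Rightarrow> real. 0 < f b \<and> f b < h \<and> sqrt (\<Sum>i\<in>I. (f i)\<^sup>2) \<le> \<tau> * f b}"
  define P where "P = Pi\<^sub>M (insert b I) (\<lambda>_. lborel :: real measure)"
  have [measurable]: "S \<inter> space P \<in> sets P"
  proof -
    have [simp]: "(\<lambda>f. f i) \<in> borel_measurable P" if "i \<in> insert b I" for i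
      using that measurable_component_singleton[of i "insert b I" "\<lambda>_. lborel"] by (simp add: P_def)
    define e where "e = (\<lambda>f :: 'a \<Rightarrow> real. f b)"
    have [measurable]: "e \<in> borel_measurable P" by (simp add: e_def)
    define g where "g = (\<lambda>f :: 'a \<Rightarrow> real. sqrt (\<Sum>i\<in>I. (f i)\<^sup>2))"
    have [measurable]: "g \<in> borel_measurable P"
      unfolding g_def
      by (intro borel_measurable_continuous_on[of sqrt] borel_measurable_sum borel_measurable_power
          continuous_intros) simp
    have e: "(\<lambda>f. e f * \<tau>) \<in> borel_measurable P" by measurable
    have "{f \<in> space P. g f \<le> e f * \<tau>} \<in> sets P"
      using e by (rule borel_measurable_le[rotated]) measurable
    then have "{f \<in> space P. 0 < e f \<and> e f < h \<and> g f \<le> e f * \<tau>} \<in> sets P"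
      by measurable
    also have "{f \<in> space P. 0 < e f \<and> e f < h \<and> g f \<le> e f * \<tau>} = S \<inter> space P"
      by (auto simp: S_def g_def e_def mult.commute)
    finally show ?thesis .
  qed
  have "emeasure lborel {z :: 'a. 0 < z \<bullet> b \<and> z \<bullet> b < h \<and> sqrt (\<Sum>i\<in>Basis - {b}. (z \<bullet> i)\<^sup>2) \<le> \<tau> * (z \<bullet> b)} =
      emeasure P ((\<lambda>f. \<Sum>b\<in>Basis. f b *\<^sub>R b) -` {z :: 'a. 0 < z \<bullet> b \<and> z \<bullet> b < h \<and>
        sqrt (\<Sum>i\<in>Basis - {b}. (z \<bullet> i)\<^sup>2) \<le> \<tau> * (z \<bullet> b)} \<inter> space P)"
    unfolding P_def I(3) by (subst lborel_eq, subst emeasure_distr) auto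
  also have "(\<lambda>f. \<Sum>b\<in>Basis. f b *\<^sub>R b) -` {z :: 'a. 0 < z \<bullet> b \<and> z \<bullet> b < h \<and>
        sqrt (\<Sum>i\<in>Basis - {b}. (z \<bullet> i)\<^sup>2) \<le> \<tau> * (z \<bullet> b)} = S"
    using b by (auto simp: S_def I_def)
  also have "emeasure P (S \<inter> space P) = (\<integral>\<^sup>+f. indicator (S \<inter> space P) f \<partial>P)"
    by simp
  also have "\<dots> = (\<integral>\<^sup>+y. \<integral>\<^sup>+f. indicator (S \<inter> space P) (f(b := y)) \<partial>Pi\<^sub>M I (\<lambda>_. lborel) \<partial>lborel)"
  proof -
    have "indicator (S \<inter> space P) \<in> borel_measurable P" by measurable
    then show ?thesis unfolding P_def using I(1,2) by (intro product_nn_integral_insert_rev)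
  qed
  also have "\<dots> = (\<integral>\<^sup>+y. ennreal (unit_ball_vol d * (\<tau> * y) ^ d) * indicator {0..h} y \<partial>lborel)"
  proof (intro nn_integral_cong_AE)
    \<comment> \<open>The cone has open height bounds, while the fundamental theorem is applied on a
      closed interval; the two endpoints form a null set.\<close>
    have "AE y in lborel. y \<notin> {0, h}"
      by (intro AE_not_in countable_imp_null_set_lborel) auto
    then show "AE y in lborel. (\<integral>\<^sup>+f. indicator (S \<inter> space P) (f(b := y)) \<partial>Pi\<^sub>M I (\<lambda>_. lborel)) =
        ennreal (unit_ball_vol d * (\<tau> * y) ^ d) * indicator {0..h} y"
    proof eventually_elim
      case (elim y)
      define Q where "Q = {f. sqrt (\<Sum>i\<in>I. (f i)\<^sup>2) \<le> \<tau> * y} \<inter> space (Pi\<^sub>M I (\<lambda>_. lborel :: real measure))"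
      have upd: "(\<Sum>i\<in>I. ((f(b := y)) i)\<^sup>2) = (\<Sum>i\<in>I. (f i)\<^sup>2)" for f
        using I(2) by (intro sum.cong) auto
      have "(\<integral>\<^sup>+f. indicator (S \<inter> space P) (f(b := y)) \<partial>Pi\<^sub>M I (\<lambda>_. lborel)) =
          (\<integral>\<^sup>+f. indicator {0<..<h} y * indicator Q f \<partial>Pi\<^sub>M I (\<lambda>_. lborel))"
      proof (intro nn_integral_cong)
        fix f assume "f \<in> space (Pi\<^sub>M I (\<lambda>_. lborel :: real measure))"
        then show "indicator (S \<inter> space P) (f(b := y)) = (indicator {0<..<h} y * indicator Q f :: ennreal)"
          unfolding S_def Q_def P_def space_PiM
          by (auto simp: indicator_def upd simp del: fun_upd_apply) (auto simp: PiE_def extensional_def split: if_splits)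
      qed
      also have "\<dots> = indicator {0<..<h} y * emeasure (Pi\<^sub>M I (\<lambda>_. lborel)) Q"
      proof -
        have "Q \<in> sets (Pi\<^sub>M I (\<lambda>_. lborel))" using I(1) unfolding Q_def by measurable
        then show ?thesis by (simp add: nn_integral_cmult)
      qed
      also have "\<dots> = ennreal (unit_ball_vol d * (\<tau> * y) ^ d) * indicator {0..h} y"
      proof (cases "0 < y \<and> y < h")
        case True
        then have "emeasure (Pi\<^sub>M I (\<lambda>_. lborel)) Q = ennreal (unit_ball_vol d * (\<tau> * y) ^ d)"
          using emeasure_cball_aux[of I "\<tau> * y"] I \<tau> by (simp add: Q_def)
        then show ?thesis using True by simp
      qed (use elim in auto)
      finally show ?case .
    qed
  qed
  also have "\<dots> = ennreal (unit_ball_vol d * \<tau> ^ d * h ^ (d + 1) / (d + 1) -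
      unit_ball_vol d * \<tau> ^ d * 0 ^ (d + 1) / (d + 1))"
  proof (rule nn_integral_FTC_Icc[where F = "\<lambda>y. unit_ball_vol d * \<tau> ^ d * y ^ (d + 1) / (d + 1)"])
    show "((\<lambda>y. unit_ball_vol d * \<tau> ^ d * y ^ (d + 1) / (d + 1)) has_real_derivative
        unit_ball_vol d * (\<tau> * y) ^ d) (at y)" for y
    proof -
      have "((\<lambda>y. unit_ball_vol d * \<tau> ^ d / (d + 1) * y ^ (d + 1)) has_real_derivative
        unit_ball_vol d * \<tau> ^ d / (d + 1) * (real (d + 1) * y ^ (d + 1 - 1))) (at y)"
        by (intro DERIV_cmult DERIV_pow[THEN DERIV_cong]) auto
      then show ?thesis by (simp add: power_mult_distrib del: of_nat_add of_nat_Suc)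
    qed
    show "0 \<le> unit_ball_vol d * (\<tau> * y) ^ d" if "y \<in> {0..h}" for y
      using that \<tau> by simp
  qed (use h in auto)
  finally show ?thesis by simp
qed

text \<open>Here \<open>c\<close> is the cosine and \<open>\<tau>\<close> the tangent of the angle
  between the axis and the boundary of the cone. Cutting the cone by the unit sphere gives a curved
  top, which lies between the flat tops at heights \<open>c\<close> and 1.\<close>

lemma curved_cone_sandwich:
  fixes b :: "'a::euclidean_space"
  defines "R \<equiv> \<lambda>z. sqrt (\<Sum>i\<in>Basis - {b}. (z \<bullet> i)\<^sup>2)"
  assumes b: "b \<in> Basis" and c: "0 < c" and \<tau>: "\<tau> \<ge> 0" "\<tau>\<^sup>2 * c\<^sup>2 = 1 - c\<^sup>2"
  shows "{z. 0 < z \<bullet> b \<and> z \<bullet> b < c \<and> R z \<le> \<tau> * (z \<bullet> b)} \<subseteq>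
      {z. 0 < norm z \<and> norm z < 1 \<and> c * norm z \<le> b \<bullet> z}"
    and "{z. 0 < norm z \<and> norm z < 1 \<and> c * norm z \<le> b \<bullet> z} \<subseteq>
      {z. 0 < z \<bullet> b \<and> z \<bullet> b < 1 \<and> R z \<le> \<tau> * (z \<bullet> b)}"
proof -
  have R0: "R z \<ge> 0" for z by (simp add: R_def sum_nonneg)
  have nrm: "(norm z)\<^sup>2 = (z \<bullet> b)\<^sup>2 + (R z)\<^sup>2" for z
  proof -
    have "(norm z)\<^sup>2 = (\<Sum>i\<in>Basis. (z \<bullet> i)\<^sup>2)"
      by (subst power2_norm_eq_inner, subst euclidean_inner) (simp add: power2_eq_square)
    then show ?thesis using b by (simp add: R_def sum_nonneg sum.remove[of Basis b])
  qed
  have iff: "c * norm z \<le> z \<bullet> b \<longleftrightarrow> R z \<le> \<tau> * (z \<bullet> b)" if "0 < z \<bullet> b" for z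
  proof -
    have "c * norm z \<le> z \<bullet> b \<longleftrightarrow> (c * norm z)\<^sup>2 \<le> (z \<bullet> b)\<^sup>2"
      using that c by (subst power_mono_iff) auto
    also have "\<dots> \<longleftrightarrow> c\<^sup>2 * (R z)\<^sup>2 \<le> (\<tau>\<^sup>2 * c\<^sup>2) * (z \<bullet> b)\<^sup>2"
      unfolding \<tau>(2) power_mult_distrib nrm by (auto simp: algebra_simps)
    also have "\<dots> \<longleftrightarrow> c\<^sup>2 * (R z)\<^sup>2 \<le> c\<^sup>2 * (\<tau> * (z \<bullet> b))\<^sup>2"
      by (simp add: power_mult_distrib mult_ac)
    also have "\<dots> \<longleftrightarrow> R z \<le> \<tau> * (z \<bullet> b)"
      using that \<tau> R0[of z] c by (simp add: power_mono_iff)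
    finally show ?thesis .
  qed
  show "{z. 0 < z \<bullet> b \<and> z \<bullet> b < c \<and> R z \<le> \<tau> * (z \<bullet> b)} \<subseteq>
      {z. 0 < norm z \<and> norm z < 1 \<and> c * norm z \<le> b \<bullet> z}"
  proof safe
    fix z assume z: "0 < z \<bullet> b" "z \<bullet> b < c" "R z \<le> \<tau> * (z \<bullet> b)"
    then show "c * norm z \<le> b \<bullet> z" using iff[OF z(1)] by (simp add: inner_commute)
    moreover have "b \<bullet> z < c" using z by (simp add: inner_commute)
    ultimately have "c * norm z < c * 1" by linarith
    then show "norm z < 1" using mult_less_cancel_left_pos[OF c] by blast
    show "0 < norm z" using z by auto
  qed
  show "{z. 0 < norm z \<and> norm z < 1 \<and> c * norm z \<le> b \<bullet> z} \<subseteq>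
      {z. 0 < z \<bullet> b \<and> z \<bullet> b < 1 \<and> R z \<le> \<tau> * (z \<bullet> b)}"
  proof safe
    fix z assume z: "0 < norm z" "norm z < 1" "c * norm z \<le> b \<bullet> z"
    show pos: "0 < z \<bullet> b" using z c by (metis inner_commute less_le_trans mult_pos_pos)
    show "R z \<le> \<tau> * (z \<bullet> b)" using iff[OF pos] z by (simp add: inner_commute)
    show "z \<bullet> b < 1" using Basis_le_norm[OF b, of z] z by linarith
  qed
qed

text \<open>The limit of \<open>\<sigma>(cap of radius \<rho>) / \<rho> ^ d\<close> as \<open>\<rho>\<close> tends to 0.\<close>

definition cap_constant :: "nat \<Rightarrow> real" where
  "cap_constant d = unit_ball_vol (real d) / (real (d + 1) * unit_ball_vol (real (d + 1)))"

lemma cap_constant_pos: "cap_constant d > 0"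
  unfolding cap_constant_def by (intro divide_pos_pos mult_pos_pos unit_ball_vol_pos) auto

text \<open>Half of this value is the coefficient in the theorem, the half being the one in the
  energy. The ball volumes leave two Gamma values shifted by 1, which the functional equation
  reduces.\<close>

lemma cap_constant_altdef:
  assumes "d \<ge> 1"
  shows "d * cap_constant d = 1 / sqrt pi * (Gamma (d / 2 + 1 / 2) / Gamma (d / 2))"
proof -
  have G1: "Gamma (real d / 2 + 1) = real d / 2 * Gamma (real d / 2)"
    using assms by (intro Gamma_plus1) (auto dest: nonpos_Ints_nonpos)
  have "Gamma ((real d / 2 + 1 / 2) + 1) = (real d / 2 + 1 / 2) * Gamma (real d / 2 + 1 / 2)"
    by (rule Gamma_plus1) (auto dest: nonpos_Ints_nonpos)
  then have G2: "Gamma (real (d + 1) / 2 + 1) = real (d + 1) / 2 * Gamma (real d / 2 + 1 / 2)"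
    by (simp add: add_divide_distrib)
  have pi: "pi powr (real (d + 1) / 2) = pi powr (real d / 2) * sqrt pi"
    by (simp add: add_divide_distrib powr_add powr_half_sqrt)
  define g1 g2 p n where "g1 = Gamma (real d / 2)" and "g2 = Gamma (real d / 2 + 1 / 2)"
    and "p = pi powr (real d / 2)" and "n = real (d + 1)"
  have pos: "g1 > 0" "g2 > 0" "p > 0" "n > 0" "real d > 0"
    using assms by (auto simp: g1_def g2_def p_def n_def intro!: Gamma_real_pos)
  have "cap_constant d = p / (real d / 2 * g1) / (n * (p * sqrt pi / (n / 2 * g2)))"
    unfolding cap_constant_def unit_ball_vol_def G1 G2 pi g1_def g2_def p_def n_def by (rule refl)
  also have "real d * \<dots> = 1 / sqrt pi * (g2 / g1)"
    using pos by (simp add: field_simps)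
  finally show ?thesis by (simp add: g1_def g2_def)
qed

text \<open>A chord of length \<open>\<rho>\<close> spans an angle with cosine \<open>c\<close> and
  sine \<open>\<rho> * sqrt (1 - \<rho>^2 / 4)\<close>, so \<open>\<tau>\<close> is its tangent.
  After a rotation taking a basis vector to \<open>x\<close>, the cone over the cap is the one
  enclosed by \<open>curved_cone_sandwich\<close>; division by the total mass turns its volume into
  multiples of \<open>cap_constant d\<close>.\<close>

lemma cap_measure_bounds:
  fixes x :: "real ^ 'n"
  assumes dim: "CARD('n) = d + 1" and x: "norm x = 1" and \<rho>: "0 < \<rho>" "\<rho> \<le> 1"
  defines "V \<equiv> measure normalized_surface_measure {y \<in> sphere 0 1. norm (x - y) \<le> \<rho>}"
  defines "c \<equiv> 1 - \<rho>\<^sup>2 / 2"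
  defines "\<tau> \<equiv> \<rho> * sqrt (1 - \<rho>\<^sup>2 / 4) / c"
  shows "cap_constant d * \<tau> ^ d * c ^ (d + 1) \<le> V" and "V \<le> cap_constant d * \<tau> ^ d"
proof -
  have \<rho>2: "\<rho>\<^sup>2 \<le> 1" using \<rho> by (simp add: power_le_one)
  have c: "0 < c" using \<rho>2 by (simp add: c_def)
  have \<tau>0: "\<tau> > 0" using \<rho> \<rho>2 c by (simp add: \<tau>_def)
  have "(\<tau> * c)\<^sup>2 = \<rho>\<^sup>2 * (1 - \<rho>\<^sup>2 / 4)"
    using c \<rho>2 by (simp add: \<tau>_def power_mult_distrib)
  also have "\<dots> = 1 - c\<^sup>2" by (simp add: c_def power2_eq_square algebra_simps)
  finally have \<tau>c: "\<tau>\<^sup>2 * c\<^sup>2 = 1 - c\<^sup>2" by (simp add: power_mult_distrib)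
  define cap where "cap = {y \<in> sphere 0 1. norm (x - y) \<le> \<rho>}"
  have "cap = cball x \<rho> \<inter> sphere 0 1" by (auto simp: cap_def dist_norm)
  then have cap: "cap \<in> sets (restrict_space borel (sphere 0 1))"
    by (auto simp: sets_restrict_space_iff)
  obtain b :: "real ^ 'n" where b: "b \<in> Basis" using nonempty_Basis by blast
  obtain T where T: "orthogonal_transformation T" "T b = x"
    using orthogonal_transformation_exists_1[of b x] b x by auto
  define K where "K w = {z :: real ^ 'n. 0 < norm z \<and> norm z < 1 \<and> c * norm z \<le> w \<bullet> z}" for w
  have K [measurable]: "K w \<in> sets borel" for w unfolding K_def by measurable
  have K_x: "{r *\<^sub>R y | r y. 0 < r \<and> r < 1 \<and> y \<in> cap} = K x"
  proof -
    have in_cap: "y \<in> cap \<longleftrightarrow> c \<le> x \<bullet> y" if "norm y = 1" for y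
    proof -
      have "norm (x - y) \<le> \<rho> \<longleftrightarrow> (norm (x - y))\<^sup>2 \<le> \<rho>\<^sup>2"
        using \<rho> by (subst power_mono_iff) auto
      also have "(norm (x - y))\<^sup>2 = 2 - 2 * (x \<bullet> y)"
        using x that by (rule dist_sphere_inner)
      finally show ?thesis using that by (auto simp: cap_def c_def)
    qed
    show ?thesis
    proof safe
      fix r y assume r: "0 < r" "r < (1 :: real)" "y \<in> cap"
      then have "norm y = 1" by (simp add: cap_def)
      then show "r *\<^sub>R y \<in> K x" using r in_cap[of y] by (auto simp: K_def mult.commute)
    next
      fix z assume z: "z \<in> K x"
      then have "norm (sgn z) = 1" by (auto simp: K_def norm_sgn)
      moreover have "c \<le> x \<bullet> sgn z" using z by (simp add: K_def sgn_div_norm field_simps)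
      ultimately have "sgn z \<in> cap" using in_cap by blast
      moreover have "z = norm z *\<^sub>R sgn z" using z by (simp add: K_def sgn_div_norm)
      ultimately show "\<exists>r y. z = r *\<^sub>R y \<and> 0 < r \<and> r < 1 \<and> y \<in> cap"
        using z unfolding K_def by blast
    qed
  qed
  have "T -` K x = K b"
  proof -
    have "norm (T z) = norm z" "x \<bullet> T z = b \<bullet> z" for z
      using T by (auto simp: orthogonal_transformation_norm orthogonal_transformation_def)
    then show ?thesis by (simp only: K_def vimage_def mem_Collect_eq)
  qed
  then have K_eq: "emeasure lborel (K x) = emeasure lborel (K b)"
    using emeasure_lborel_orthogonal_vimage[OF T(1) K, of x] by simp
  define v where "v h = unit_ball_vol d * \<tau> ^ d * h ^ (d + 1) / (d + 1)" for h :: real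
  have "K b \<subseteq> ball 0 1" by (auto simp: K_def)
  then have fin: "emeasure lborel (K b) < \<infinity>"
    using emeasure_mono[of "K b" "ball 0 1" lborel] emeasure_lborel_ball_finite[of "0 :: real ^ 'n" 1]
    by (auto intro: le_less_trans)
  have cone_meas: "{z :: real ^ 'n. 0 < z \<bullet> b \<and> z \<bullet> b < h \<and>
      sqrt (\<Sum>i\<in>Basis - {b}. (z \<bullet> i)\<^sup>2) \<le> \<tau> * (z \<bullet> b)} \<in> sets lborel" for h
    by measurable
  have vol: "v c \<le> measure lborel (K b)" "measure lborel (K b) \<le> v 1"
  proof -
    have eq: "emeasure lborel (K b) = ennreal (measure lborel (K b))"
      using fin by (intro emeasure_eq_ennreal_measure) auto
    have "ennreal (v c) = emeasure lborel {z :: real ^ 'n. 0 < z \<bullet> b \<and> z \<bullet> b < c \<and>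
        sqrt (\<Sum>i\<in>Basis - {b}. (z \<bullet> i)\<^sup>2) \<le> \<tau> * (z \<bullet> b)}"
      unfolding v_def using emeasure_straight_cone[OF b _ \<tau>0 c] dim by (simp add: add_ac)
    also have "\<dots> \<le> emeasure lborel (K b)"
      unfolding K_def using \<tau>0 K[of b, unfolded K_def]
      by (intro emeasure_mono curved_cone_sandwich(1)[OF b c _ \<tau>c]) auto
    finally show "v c \<le> measure lborel (K b)" by (simp add: eq)
    have "emeasure lborel (K b) \<le> emeasure lborel {z :: real ^ 'n. 0 < z \<bullet> b \<and> z \<bullet> b < 1 \<and>
        sqrt (\<Sum>i\<in>Basis - {b}. (z \<bullet> i)\<^sup>2) \<le> \<tau> * (z \<bullet> b)}"
      unfolding K_def using \<tau>0
      by (intro emeasure_mono curved_cone_sandwich(2)[OF b c _ \<tau>c] cone_meas) auto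
    also have "\<dots> = ennreal (v 1)"
      unfolding v_def using emeasure_straight_cone[OF b _ \<tau>0 zero_less_one] dim by (simp add: add_ac)
    finally have "ennreal (measure lborel (K b)) \<le> ennreal (v 1)" by (simp add: eq)
    then show "measure lborel (K b) \<le> v 1"
      using \<tau>0 by (subst (asm) ennreal_le_iff) (auto simp: v_def)
  qed
  have ball_pos: "unit_ball_vol (d + 1) > 0" by (rule unit_ball_vol_pos) auto
  have "V = measure lborel (K b) / unit_ball_vol (d + 1)"
  proof -
    have "emeasure normalized_surface_measure cap =
        emeasure surface_measure (sphere 0 1 \<inter> cap) / emeasure surface_measure (sphere (0 :: real ^ 'n) 1)"
      unfolding normalized_surface_measure_def
      using cap by (intro emeasure_uniform_measure) (auto simp: sets_restrict_space_iff)
    also have "sphere 0 1 \<inter> cap = cap" by (auto simp: cap_def)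
    also have "emeasure surface_measure cap = ennreal (real (d + 1) * measure lborel (K b))"
      using emeasure_surface_measure[OF cap] fin dim
      by (simp add: K_x K_eq ennreal_mult emeasure_eq_ennreal_measure ennreal_of_nat_eq_real_of_nat
          del: of_nat_add of_nat_Suc)
    also have "emeasure surface_measure (sphere (0 :: real ^ 'n) 1) =
        ennreal (real (d + 1) * unit_ball_vol (d + 1))"
      using dim by (simp add: emeasure_surface_measure_sphere emeasure_ball ennreal_mult
          ennreal_of_nat_eq_real_of_nat del: of_nat_add of_nat_Suc)
    also have "ennreal (real (d + 1) * measure lborel (K b)) / \<dots> =
        ennreal (real (d + 1) * measure lborel (K b) / (real (d + 1) * unit_ball_vol (d + 1)))"
      using ball_pos by (intro divide_ennreal) auto
    finally show ?thesis
      unfolding V_def cap_def[symmetric] measure_def using ball_pos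
      by (simp add: field_simps del: of_nat_add of_nat_Suc)
  qed
  then have "v c / unit_ball_vol (d + 1) \<le> V" "V \<le> v 1 / unit_ball_vol (d + 1)"
    using vol ball_pos by (auto intro: divide_right_mono)
  then show "cap_constant d * \<tau> ^ d * c ^ (d + 1) \<le> V" "V \<le> cap_constant d * \<tau> ^ d"
    by (simp_all add: v_def cap_constant_def mult_ac add_ac)
qed

text \<open>The right side is the chord of the convex function \<open>(1 + s)^d\<close> between
  \<open>s = 0\<close> and \<open>s = 1\<close>.\<close>

lemma one_plus_power_le:
  fixes s :: real
  assumes "0 \<le> s" "s \<le> 1"
  shows "(1 + s) ^ d \<le> 1 + (2 ^ d - 1) * s"
proof (induction d)
  case (Suc d)
  have "(1 + s) ^ Suc d \<le> (1 + s) * (1 + (2 ^ d - 1) * s)"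
    using Suc assms by (simp add: mult_left_mono)
  also have "\<dots> = 1 + 2 ^ d * s + (2 ^ d - 1) * (s * s)"
    by (simp add: algebra_simps)
  also have "(2 ^ d - 1) * (s * s) \<le> (2 ^ d - 1) * (s * 1)"
    using assms by (intro mult_left_mono) auto
  finally show ?case by (simp add: algebra_simps)
qed auto

text \<open>Both bounds of \<open>cap_measure_bounds\<close> are \<open>\<rho>^d\<close> up to a
  relative error of order \<open>s = \<rho>^2\<close>. Only order \<open>\<rho>\<close> is kept: for
  \<open>\<rho> = 1 / n\<close> this already leads to errors of order \<open>1 / n^2\<close> in the
  harmonic sum.\<close>

lemma cap_measure_asymptotics:
  fixes x :: "real ^ 'n"
  assumes "CARD('n) = d + 1" "norm x = 1" "0 < \<rho>" "\<rho> \<le> 1"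
  shows "\<bar>measure normalized_surface_measure {y \<in> sphere 0 1. norm (x - y) \<le> \<rho>} -
      cap_constant d * \<rho> ^ d\<bar> \<le> cap_constant d * 2 ^ d * \<rho> ^ (d + 1)"
proof -
  define c where "c = 1 - \<rho>\<^sup>2 / 2"
  define \<tau> where "\<tau> = \<rho> * sqrt (1 - \<rho>\<^sup>2 / 4) / c"
  define V where "V = measure normalized_surface_measure {y \<in> sphere 0 1. norm (x - y) \<le> \<rho>}"
  define s where "s = \<rho>\<^sup>2"
  note \<rho> = assms(3,4)
  have s: "0 < s" "s \<le> 1" "s \<le> \<rho>"
    using \<rho> power_decreasing[of 1 2 \<rho>] by (auto simp: s_def power_le_one)
  have c: "0 < c" "1 - s \<le> c" using s by (auto simp: c_def s_def)
  have \<kappa>: "cap_constant d > 0" by (rule cap_constant_pos)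
  note bounds = cap_measure_bounds[OF assms, folded c_def, folded \<tau>_def, folded V_def]
  have \<tau>c: "\<tau> * c = \<rho> * sqrt (1 - s / 4)" using c by (simp add: \<tau>_def s_def)
  have "\<tau> \<le> \<rho> * (1 + s)"
  proof -
    have "\<tau> * c \<le> \<rho>" unfolding \<tau>c using \<rho> s by (simp add: mult_left_le)
    also have "s * s \<le> s * 1" using s by (intro mult_left_mono) auto
    then have "1 \<le> (1 + s) * c" by (simp add: c_def s_def[symmetric] algebra_simps)
    then have "\<rho> * 1 \<le> \<rho> * ((1 + s) * c)" using \<rho> by (intro mult_left_mono) auto
    finally show ?thesis using c by (simp flip: mult.assoc)
  qed
  moreover have "0 \<le> \<tau>" using \<rho> s c by (simp add: \<tau>_def s_def[symmetric])
  ultimately have "\<tau> ^ d \<le> (\<rho> * (1 + s)) ^ d" by (intro power_mono)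
  also have "\<dots> = \<rho> ^ d * (1 + s) ^ d" by (simp add: power_mult_distrib)
  also have "\<dots> \<le> \<rho> ^ d * (1 + (2 ^ d - 1) * s)"
    using \<rho> s by (intro mult_left_mono one_plus_power_le) auto
  also have "\<dots> \<le> \<rho> ^ d * (1 + 2 ^ d * \<rho>)"
    using \<rho> s by (intro mult_left_mono add_left_mono mult_mono) auto
  also have "\<dots> = \<rho> ^ d + 2 ^ d * \<rho> ^ (d + 1)" by (simp add: algebra_simps)
  finally have "cap_constant d * \<tau> ^ d \<le> cap_constant d * (\<rho> ^ d + 2 ^ d * \<rho> ^ (d + 1))"
    using \<kappa> by (intro mult_left_mono) auto
  with bounds(2) have upper: "V \<le> cap_constant d * \<rho> ^ d + cap_constant d * 2 ^ d * \<rho> ^ (d + 1)"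
    by (simp add: algebra_simps)
  have "sqrt (1 - s / 4) \<ge> 1 - s"
    using s mult_left_mono[of s 1 s] by (intro real_le_rsqrt) (simp add: power2_eq_square algebra_simps)
  then have "(\<rho> * (1 - s)) ^ d * (1 - s) \<le> (\<tau> * c) ^ d * c"
    unfolding \<tau>c using c s \<rho> by (intro mult_mono power_mono mult_left_mono) auto
  moreover have "1 - real (d + 1) * s \<le> (1 - s) ^ (d + 1)"
    using Bernoulli_inequality[of "- s" "d + 1"] s by simp
  then have "\<rho> ^ d * (1 - real (d + 1) * s) \<le> \<rho> ^ d * (1 - s) ^ (d + 1)"
    using \<rho> by (intro mult_left_mono) auto
  moreover have "real (d + 1) \<le> 2 ^ d"
    by (metis Suc_eq_plus1 Suc_leI less_exp of_nat_le_iff of_nat_numeral of_nat_power)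
  then have "real (d + 1) * s \<le> 2 ^ d * \<rho>" using s by (intro mult_mono) auto
  then have "\<rho> ^ d * (1 - 2 ^ d * \<rho>) \<le> \<rho> ^ d * (1 - real (d + 1) * s)"
    using \<rho> by (intro mult_left_mono) auto
  moreover have "(\<rho> * (1 - s)) ^ d * (1 - s) = \<rho> ^ d * (1 - s) ^ (d + 1)"
    "(\<tau> * c) ^ d * c = \<tau> ^ d * c ^ (d + 1)"
    "\<rho> ^ d * (1 - 2 ^ d * \<rho>) = \<rho> ^ d - 2 ^ d * \<rho> ^ (d + 1)"
    unfolding power_mult_distrib by (simp_all add: algebra_simps)
  ultimately have "\<rho> ^ d - 2 ^ d * \<rho> ^ (d + 1) \<le> \<tau> ^ d * c ^ (d + 1)"
    by linarith
  then have "cap_constant d * (\<rho> ^ d - 2 ^ d * \<rho> ^ (d + 1)) \<le> cap_constant d * (\<tau> ^ d * c ^ (d + 1))"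
    using \<kappa> by (intro mult_left_mono) auto
  with bounds(1) have "cap_constant d * \<rho> ^ d - cap_constant d * 2 ^ d * \<rho> ^ (d + 1) \<le> V"
    by (simp add: algebra_simps)
  with upper show ?thesis unfolding V_def by linarith
qed

section \<open>Integrals of zonal kernels\<close>

text \<open>
  \<open>inv_floor m r ^ d\<close> is a step function close to the truncated kernel \<open>min (1 / r) m ^ d\<close>: it is a
  combination of indicators of the caps of radius \<open>1 / n\<close>, \<open>n \<le> m\<close>, so its integral is a sum over \<open>n\<close>
  whose leading part is the harmonic sum.
\<close>

definition inv_floor :: "nat \<Rightarrow> real \<Rightarrow> nat" where
  "inv_floor m r = (if r \<le> 0 then m else min m (nat \<lfloor>1 / r\<rfloor>))"

lemma inv_floor_le: "inv_floor m r \<le> m"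
  by (simp add: inv_floor_def)

text \<open>The product form is used instead of \<open>r \<le> 1 / n\<close> because it is also
  correct at \<open>n = 0\<close>. For \<open>r \<le> 0\<close> both sides are true, which matches
  the value \<open>m\<close> chosen there.\<close>

lemma le_inv_floor_iff:
  assumes "n \<le> m"
  shows "n \<le> inv_floor m r \<longleftrightarrow> real n * r \<le> 1"
proof (cases "r \<le> 0")
  case True
  then have "real n * r \<le> 0" by (simp add: mult_nonneg_nonpos)
  then show ?thesis using True assms by (simp add: inv_floor_def)
next
  case False
  then have "n \<le> inv_floor m r \<longleftrightarrow> real n \<le> 1 / r"
    using assms by (simp add: inv_floor_def le_nat_iff le_floor_iff)
  also have "\<dots> \<longleftrightarrow> real n * r \<le> 1" using False by (simp add: field_simps)
  finally show ?thesis .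
qed

text \<open>Layer-cake decomposition: \<open>l^k\<close> telescopes into its increments up to
  \<open>l\<close>, and the \<open>n\<close>-th increment is present exactly when \<open>r\<close>
  lies within \<open>1 / n\<close>. The condition \<open>k \<ge> 1\<close> makes the sum start from
  \<open>0^k = 0\<close>.\<close>

lemma inv_floor_power:
  assumes "k \<ge> 1"
  shows "real (inv_floor m r) ^ k =
    (\<Sum>n = 1..m. (real n ^ k - real (n - 1) ^ k) * (if real n * r \<le> 1 then 1 else 0))"
proof -
  have tele: "(\<Sum>n = 1..l. real n ^ k - real (n - 1) ^ k) = real l ^ k" for l
    using assms by (induction l) auto
  have "(\<Sum>n = 1..m. (real n ^ k - real (n - 1) ^ k) * (if real n * r \<le> 1 then 1 else 0)) =
      (\<Sum>n\<in>{1..m}. if n \<le> inv_floor m r then real n ^ k - real (n - 1) ^ k else 0)"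
    by (intro sum.cong) (auto simp: le_inv_floor_iff)
  also have "\<dots> = (\<Sum>n = 1..inv_floor m r. real n ^ k - real (n - 1) ^ k)"
    by (subst sum.inter_filter[symmetric])
       (auto intro!: sum.cong intro: order_trans[OF _ inv_floor_le])
  finally show ?thesis by (simp only: tele)
qed

lemma finite_measure_normalized_surface_measure:
  "finite_measure (normalized_surface_measure :: 'a::euclidean_space measure)"
  by (rule finite_measureI) (simp add: emeasure_normalized_surface_measure_sphere)

lemma measure_normalized_surface_measure_space:
  "measure normalized_surface_measure (sphere (0 :: 'a::euclidean_space) 1) = 1"
  by (simp add: measure_def emeasure_normalized_surface_measure_sphere)

lemma cap_sets:
  "{y \<in> sphere 0 1. norm (x - y) \<le> \<rho>} \<in> sets (normalized_surface_measure :: 'a::euclidean_space measure)"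
proof -
  have "{y \<in> sphere 0 1. norm (x - y) \<le> \<rho>} = cball x \<rho> \<inter> sphere 0 1"
    by (auto simp: dist_norm)
  then show ?thesis by (auto simp: sets_restrict_space_iff)
qed

lemma inv_floor_integral:
  fixes x :: "'a::euclidean_space"
  assumes "k \<ge> 1"
  defines "\<sigma> \<equiv> normalized_surface_measure"
  shows "integrable \<sigma> (\<lambda>y. real (inv_floor m (norm (x - y))) ^ k)"
    and "(\<integral>y. real (inv_floor m (norm (x - y))) ^ k \<partial>\<sigma>) =
      (\<Sum>n = 1..m. (real n ^ k - real (n - 1) ^ k) *
         measure \<sigma> {y \<in> sphere 0 1. norm (x - y) \<le> 1 / real n})"
proof -
  interpret finite_measure \<sigma>
    unfolding \<sigma>_def by (rule finite_measure_normalized_surface_measure)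
  define cap where "cap n = {y \<in> sphere 0 1. norm (x - y) \<le> 1 / real n}" for n
  have cap: "cap n \<in> sets \<sigma>" for n unfolding cap_def \<sigma>_def by (rule cap_sets)
  have fin: "emeasure \<sigma> (cap n) < \<infinity>" for n
    using emeasure_finite[of "cap n"] unfolding infinity_ennreal_def less_top[symmetric] by simp
  have eq: "real (inv_floor m (norm (x - y))) ^ k =
      (\<Sum>n = 1..m. (real n ^ k - real (n - 1) ^ k) * indicator (cap n) y)" if "y \<in> space \<sigma>" for y
    unfolding inv_floor_power[OF assms(1)] using that
    by (intro sum.cong refl) (auto simp: cap_def \<sigma>_def indicator_def field_simps)
  have int: "integrable \<sigma> (\<lambda>y. \<Sum>n = 1..m. (real n ^ k - real (n - 1) ^ k) * indicator (cap n) y)"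
    using cap fin by (intro Bochner_Integration.integrable_sum integrable_mult_right integrable_real_indicator) (auto simp: less_top)
  show "integrable \<sigma> (\<lambda>y. real (inv_floor m (norm (x - y))) ^ k)"
    using int by (subst Bochner_Integration.integrable_cong[OF refl eq])
  have "(\<integral>y. real (inv_floor m (norm (x - y))) ^ k \<partial>\<sigma>) =
      (\<integral>y. (\<Sum>n = 1..m. (real n ^ k - real (n - 1) ^ k) * indicator (cap n) y) \<partial>\<sigma>)"
    by (intro Bochner_Integration.integral_cong refl eq)
  also have "\<dots> = (\<Sum>n = 1..m. (real n ^ k - real (n - 1) ^ k) * measure \<sigma> (cap n))"
    using cap fin sets.Int_space_eq2[OF cap]
    by (subst Bochner_Integration.integral_sum) (auto simp: less_top intro!: integrable_mult_right integrable_real_indicator)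
  finally show "(\<integral>y. real (inv_floor m (norm (x - y))) ^ k \<partial>\<sigma>) =
      (\<Sum>n = 1..m. (real n ^ k - real (n - 1) ^ k) * measure \<sigma> {y \<in> sphere 0 1. norm (x - y) \<le> 1 / real n})"
    by (simp add: cap_def)
qed

lemma sum_inverse_squares_le: "(\<Sum>n = 1..m. 1 / (real n)\<^sup>2) \<le> 2"
proof (cases m)
  case (Suc l)
  have "(\<Sum>n = 1..Suc l. 1 / (real n)\<^sup>2) \<le> 2 - 1 / real (Suc l)"
  proof (induction l)
    case (Suc l)
    have "1 / (real (Suc (Suc l)))\<^sup>2 \<le> 1 / (real (Suc l) * real (Suc (Suc l)))"
      unfolding power2_eq_square by (intro divide_left_mono mult_right_mono) auto
    also have "\<dots> = 1 / real (Suc l) - 1 / real (Suc (Suc l))"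
      by (simp add: field_simps)
    finally have "1 / (real (Suc (Suc l)))\<^sup>2 \<le> 1 / real (Suc l) - 1 / real (Suc (Suc l))" .
    then show ?case using Suc.IH by (simp only: sum.cl_ivl_Suc) simp
  qed simp
  also have "\<dots> \<le> 2" by simp
  finally show ?thesis using Suc by simp
qed simp

text \<open>An upper counterpart of Bernoulli's inequality; together they pin
  \<open>1 - (1 - u)^d\<close> to \<open>d u\<close> within \<open>d^2 u^2\<close>.\<close>

lemma one_minus_power_le:
  fixes u :: real
  assumes "0 \<le> u" "u \<le> 1"
  shows "(1 - u) ^ d \<le> 1 - real d * u + real d ^ 2 * u\<^sup>2"
proof (induction d)
  case (Suc d)
  have "(1 - u) ^ Suc d \<le> (1 - u) * (1 - real d * u + real d ^ 2 * u\<^sup>2)"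
    using Suc assms by (simp add: mult_left_mono)
  also have "\<dots> = 1 - real (Suc d) * u + (real d + real d ^ 2) * u\<^sup>2 - real d ^ 2 * (u * u\<^sup>2)"
    by (simp add: algebra_simps power2_eq_square)
  also have "\<dots> \<le> 1 - real (Suc d) * u + real (Suc d) ^ 2 * u\<^sup>2"
  proof -
    have "0 \<le> real d ^ 2 * (u * u\<^sup>2)" using assms by simp
    moreover have "(real d + real d ^ 2) * u\<^sup>2 \<le> real (Suc d) ^ 2 * u\<^sup>2"
      by (intro mult_right_mono) (auto simp: power2_eq_square algebra_simps)
    ultimately show ?thesis by linarith
  qed
  finally show ?case .
qed auto

text \<open>A cap of radius \<open>1 / n\<close> has measure \<open>\<kappa> n^(-d)\<close> up to a
  relative error \<open>O(1 / n)\<close>, and the increment of \<open>n^k\<close> is about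
  \<open>k n^(k - 1)\<close>. The \<open>n\<close>-th term for exponent \<open>k\<close> is thus of
  order \<open>n^(k - 1 - d)\<close>: summable for \<open>k = d - 1\<close>, bounded for
  \<open>k = d + 1\<close>, and \<open>d \<kappa> / n + O(1 / n^2)\<close> for
  \<open>k = d\<close>.\<close>

lemma inv_floor_integral_bounds:
  fixes x :: "real ^ 'n"
  assumes dim: "CARD('n) = d + 1" and d: "d \<ge> 2" and x: "norm x = 1"
  defines "\<sigma> \<equiv> normalized_surface_measure" and "\<kappa> \<equiv> cap_constant d"
  shows "(\<integral>y. real (inv_floor m (norm (x - y))) ^ (d - 1) \<partial>\<sigma>) \<le> 2 * real d * (\<kappa> * (1 + 2 ^ d))"
    and "(\<integral>y. real (inv_floor m (norm (x - y))) ^ (d + 1) \<partial>\<sigma>) \<le> real (d + 1) * (\<kappa> * (1 + 2 ^ d)) * m"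
    and "\<bar>(\<integral>y. real (inv_floor m (norm (x - y))) ^ d \<partial>\<sigma>) - real d * \<kappa> * (\<Sum>n = 1..m. 1 / real n)\<bar>
      \<le> 2 * (real d * \<kappa> * 2 ^ d + \<kappa> * (real d)\<^sup>2)"
proof -
  define V where "V n = measure \<sigma> {y \<in> sphere 0 1. norm (x - y) \<le> 1 / real n}" for n
  have \<kappa>: "\<kappa> > 0" unfolding \<kappa>_def by (rule cap_constant_pos)
  have V: "\<bar>real n ^ d * V n - \<kappa>\<bar> \<le> \<kappa> * 2 ^ d / n" if "n \<ge> 1" for n
  proof -
    have "\<bar>V n - \<kappa> * (1 / real n) ^ d\<bar> \<le> \<kappa> * 2 ^ d * (1 / real n) ^ (d + 1)"
      unfolding V_def \<sigma>_def \<kappa>_def using that dim d x by (intro cap_measure_asymptotics) auto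
    then have "real n ^ d * \<bar>V n - \<kappa> * (1 / real n) ^ d\<bar> \<le> real n ^ d * (\<kappa> * 2 ^ d * (1 / real n) ^ (d + 1))"
      by (intro mult_left_mono) auto
    moreover have "real n ^ d * \<bar>V n - \<kappa> * (1 / real n) ^ d\<bar> = \<bar>real n ^ d * (V n - \<kappa> * (1 / real n) ^ d)\<bar>"
      by (simp add: abs_mult)
    moreover have "real n ^ d * (V n - \<kappa> * (1 / real n) ^ d) = real n ^ d * V n - \<kappa>"
      using that by (simp add: right_diff_distrib power_one_over)
    moreover have "real n ^ d * (\<kappa> * 2 ^ d * (1 / real n) ^ (d + 1)) = \<kappa> * 2 ^ d / n"
      using that by (simp add: power_one_over)
    ultimately show ?thesis by (simp only:)
  qed
  have V_le: "real n ^ d * V n \<le> \<kappa> * (1 + 2 ^ d)" if "n \<ge> 1" for n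
  proof -
    have "\<kappa> * 2 ^ d / n \<le> \<kappa> * 2 ^ d / 1" using \<kappa> that by (intro divide_left_mono) auto
    then show ?thesis using V[OF that] by (simp add: algebra_simps)
  qed
  have V0: "V n \<ge> 0" for n by (simp add: V_def)
  have pow_diff: "0 \<le> real n ^ k - real (n - 1) ^ k \<and>
      real n ^ k - real (n - 1) ^ k \<le> real k * real n ^ (k - 1)" if "n \<ge> 1" for n k
    using power_diff_le[of "real (n - 1)" "real n" k] that
    by (auto simp: of_nat_diff power_mono)
  have "(\<integral>y. real (inv_floor m (norm (x - y))) ^ (d - 1) \<partial>\<sigma>) =
      (\<Sum>n = 1..m. (real n ^ (d - 1) - real (n - 1) ^ (d - 1)) * V n)"
    unfolding V_def \<sigma>_def using d by (intro inv_floor_integral) auto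
  also have "\<dots> \<le> (\<Sum>n = 1..m. real d * (\<kappa> * (1 + 2 ^ d)) * (1 / (real n)\<^sup>2))"
  proof (rule sum_mono)
    fix n assume n: "n \<in> {1..m}"
    have "(real n ^ (d - 1) - real (n - 1) ^ (d - 1)) * V n \<le> (real (d - 1) * real n ^ (d - 1 - 1)) * V n"
      using pow_diff[of n "d - 1"] n V0 by (intro mult_right_mono) auto
    also have "\<dots> \<le> (real d * real n ^ (d - 2)) * V n"
      using V0 by (intro mult_right_mono[OF _ V0] mult_mono) (auto simp: numeral_2_eq_2)
    also have "\<dots> = real d * (real n ^ d * V n) * (1 / (real n)\<^sup>2)"
      using n d by (simp add: power_diff)
    also have "\<dots> \<le> real d * (\<kappa> * (1 + 2 ^ d)) * (1 / (real n)\<^sup>2)"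
      using V_le[of n] n by (intro mult_right_mono mult_left_mono) auto
    finally show "(real n ^ (d - 1) - real (n - 1) ^ (d - 1)) * V n \<le> real d * (\<kappa> * (1 + 2 ^ d)) * (1 / (real n)\<^sup>2)" .
  qed
  also have "\<dots> = real d * (\<kappa> * (1 + 2 ^ d)) * (\<Sum>n = 1..m. 1 / (real n)\<^sup>2)"
    by (simp only: sum_distrib_left)
  also have "\<dots> \<le> real d * (\<kappa> * (1 + 2 ^ d)) * 2"
    using \<kappa> by (intro mult_left_mono sum_inverse_squares_le) auto
  finally show "(\<integral>y. real (inv_floor m (norm (x - y))) ^ (d - 1) \<partial>\<sigma>) \<le> 2 * real d * (\<kappa> * (1 + 2 ^ d))"
    by (simp add: mult_ac)
  have "(\<integral>y. real (inv_floor m (norm (x - y))) ^ (d + 1) \<partial>\<sigma>) =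
      (\<Sum>n = 1..m. (real n ^ (d + 1) - real (n - 1) ^ (d + 1)) * V n)"
    unfolding V_def \<sigma>_def by (intro inv_floor_integral) auto
  also have "\<dots> \<le> (\<Sum>n = 1..m. real (d + 1) * (\<kappa> * (1 + 2 ^ d)))"
  proof (rule sum_mono)
    fix n assume n: "n \<in> {1..m}"
    have "(real n ^ (d + 1) - real (n - 1) ^ (d + 1)) * V n \<le> (real (d + 1) * real n ^ (d + 1 - 1)) * V n"
      using pow_diff[of n "d + 1"] n V0 by (intro mult_right_mono) auto
    also have "\<dots> = real (d + 1) * (real n ^ d * V n)" by simp
    also have "\<dots> \<le> real (d + 1) * (\<kappa> * (1 + 2 ^ d))"
      using V_le[of n] n by (intro mult_left_mono) auto
    finally show "(real n ^ (d + 1) - real (n - 1) ^ (d + 1)) * V n \<le> real (d + 1) * (\<kappa> * (1 + 2 ^ d))" .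
  qed
  also have "\<dots> = real (d + 1) * (\<kappa> * (1 + 2 ^ d)) * m" by simp
  finally show "(\<integral>y. real (inv_floor m (norm (x - y))) ^ (d + 1) \<partial>\<sigma>) \<le> real (d + 1) * (\<kappa> * (1 + 2 ^ d)) * m" .
  have "(\<integral>y. real (inv_floor m (norm (x - y))) ^ d \<partial>\<sigma>) - real d * \<kappa> * (\<Sum>n = 1..m. 1 / real n) =
      (\<Sum>n = 1..m. (real n ^ d - real (n - 1) ^ d) * V n - real d * \<kappa> * (1 / real n))"
    unfolding V_def \<sigma>_def using d
    by (subst inv_floor_integral) (auto simp: sum_subtractf sum_distrib_left)
  also have "\<bar>\<dots>\<bar> \<le> (\<Sum>n = 1..m. (real d * \<kappa> * 2 ^ d + \<kappa> * (real d)\<^sup>2) * (1 / (real n)\<^sup>2))"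
  proof (rule order_trans[OF sum_abs], rule sum_mono)
    fix n assume "n \<in> {1..m}"
    then have n: "n \<ge> 1" by simp
    define u where "u = 1 / real n"
    define w where "w = 1 - (1 - u) ^ d"
    define v where "v = real n ^ d * V n"
    have u: "0 \<le> u" "u \<le> 1" using n by (auto simp: u_def)
    have w: "0 \<le> w" "w \<le> real d * u" "\<bar>w - real d * u\<bar> \<le> (real d)\<^sup>2 * u\<^sup>2"
      using one_minus_power_le[OF u, of d] Bernoulli_inequality[of "- u" d] u
      by (auto simp: w_def power_le_one)
    have "real (n - 1) = real n * (1 - u)" using n by (simp add: u_def of_nat_diff field_simps)
    then have pw: "real (n - 1) ^ d = real n ^ d * (1 - u) ^ d"
      by (simp only: power_mult_distrib)
    have "(real n ^ d - real (n - 1) ^ d) * V n = w * v"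
      unfolding pw w_def v_def by (simp add: algebra_simps)
    \<comment> \<open>The two factors \<open>w\<close> and \<open>v\<close> are compared with
      \<open>d u\<close> and \<open>\<kappa>\<close> one at a time; each of the two resulting errors
      is of order \<open>u^2\<close>.\<close>
    then have "\<bar>(real n ^ d - real (n - 1) ^ d) * V n - real d * \<kappa> * (1 / real n)\<bar> =
        \<bar>w * (v - \<kappa>) + \<kappa> * (w - real d * u)\<bar>"
      by (simp add: u_def algebra_simps)
    also have "\<dots> \<le> \<bar>w\<bar> * \<bar>v - \<kappa>\<bar> + \<bar>\<kappa>\<bar> * \<bar>w - real d * u\<bar>"
      by (metis abs_mult abs_triangle_ineq)
    also have "\<dots> \<le> (real d * u) * (\<kappa> * 2 ^ d * u) + \<kappa> * ((real d)\<^sup>2 * u\<^sup>2)"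
      using w V[OF n] \<kappa> by (intro add_mono mult_mono) (auto simp: v_def u_def)
    also have "\<dots> = (real d * \<kappa> * 2 ^ d + \<kappa> * (real d)\<^sup>2) * u\<^sup>2"
      by (simp add: algebra_simps power2_eq_square)
    also have "u\<^sup>2 = 1 / (real n)\<^sup>2" by (simp add: u_def power_one_over)
    finally show "\<bar>(real n ^ d - real (n - 1) ^ d) * V n - real d * \<kappa> * (1 / real n)\<bar> \<le>
        (real d * \<kappa> * 2 ^ d + \<kappa> * (real d)\<^sup>2) * (1 / (real n)\<^sup>2)" .
  qed
  also have "\<dots> = (real d * \<kappa> * 2 ^ d + \<kappa> * (real d)\<^sup>2) * (\<Sum>n = 1..m. 1 / (real n)\<^sup>2)"
    by (simp only: sum_distrib_left)
  also have "\<dots> \<le> (real d * \<kappa> * 2 ^ d + \<kappa> * (real d)\<^sup>2) * 2"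
    using \<kappa> by (intro mult_left_mono sum_inverse_squares_le) auto
  finally show "\<bar>(\<integral>y. real (inv_floor m (norm (x - y))) ^ d \<partial>\<sigma>) - real d * \<kappa> * (\<Sum>n = 1..m. 1 / real n)\<bar>
      \<le> 2 * (real d * \<kappa> * 2 ^ d + \<kappa> * (real d)\<^sup>2)" by (simp add: mult.commute)
qed

text \<open>Each term on the right absorbs one source of error. If \<open>L = 0\<close>, then
  \<open>r > 1\<close> and everything is bounded. If \<open>L = m\<close>, both quantities are at
  most \<open>16^d m^d = 16^d L^(d + 1) / m\<close>, from \<open>M \<le> 4 m\<close>. In between
  \<open>1 / r\<close> is within 1 of \<open>L\<close>, so rounding costs
  \<open>O(L^(d - 1))\<close> and the polynomial approximation
  \<open>O(L^(d + 1) / m)\<close>.\<close>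

lemma kernel_inv_floor_diff:
  fixes p r M :: real and m d :: nat
  assumes p: "0 \<le> p" "p \<le> (4 * M) ^ d" and r: "0 \<le> r"
    and p_le: "0 < r \<Longrightarrow> p \<le> (1 / r) ^ d"
    and p_ge: "0 < r \<Longrightarrow> (1 / r) ^ d - p \<le> 16 * real d / M * (1 / r) ^ (d + 1)"
    and M: "real m \<le> real d * M" "M \<le> 4 * m" and m: "m \<ge> 1" and d: "d \<ge> 1"
  defines "L \<equiv> real (inv_floor m r)"
  shows "\<bar>p - L ^ d\<bar> \<le> (16 ^ d + real d * 2 ^ d + 16 * (real d)\<^sup>2 * 2 ^ (d + 1)) *
    (1 + L ^ (d - 1) + L ^ (d + 1) / m)"
    (is "_ \<le> ?C * _")
proof -
  have M0: "M > 0" using M(1) m d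
    by (metis less_le_trans mult_nonneg_nonpos not_less of_nat_0_le_iff of_nat_0_less_iff zero_less_one)
  have C: "?C \<ge> 16 ^ d" "?C \<ge> 1" "?C \<ge> real d * 2 ^ d" "?C \<ge> 16 * (real d)\<^sup>2 * 2 ^ (d + 1)"
    using one_le_power[of "16 :: real" d] by (auto simp: add_increasing add_increasing2 intro: order_trans)
  have L: "0 \<le> L" by (simp add: L_def)
  consider "inv_floor m r = 0" | "inv_floor m r = m" | "0 < inv_floor m r" "inv_floor m r < m"
    using inv_floor_le[of m r] by linarith
  then show ?thesis
  proof cases
    case 1
    then have "r > 1" using le_inv_floor_iff[of 1 m r] m by auto
    then have "p \<le> 1" using p_le by (auto intro: order_trans simp: power_le_one)
    moreover have "L = 0" using 1 by (simp add: L_def)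
    ultimately have "\<bar>p - L ^ d\<bar> \<le> 1 * 1" using p d by (simp add: power_0_left)
    also have "\<dots> \<le> ?C * (1 + L ^ (d - 1) + L ^ (d + 1) / m)"
      using C L by (intro mult_mono) auto
    finally show ?thesis .
  next
    case 2
    then have Lm: "L = m" by (simp add: L_def)
    have "(4 * M) ^ d \<le> (16 * real m) ^ d" using M M0 by (intro power_mono) auto
    then have "p \<le> 16 ^ d * real m ^ d" using p by (simp add: power_mult_distrib)
    moreover have "real m ^ d \<le> 16 ^ d * real m ^ d"
      using mult_right_mono[of 1 "16 ^ d" "real m ^ d"] by simp
    moreover have "0 \<le> real m ^ d" by simp
    ultimately have "\<bar>p - L ^ d\<bar> \<le> 16 ^ d * real m ^ d" using p unfolding Lm by linarith
    also have "\<dots> = 16 ^ d * (L ^ (d + 1) / m)" using m by (simp add: Lm)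
    also have "\<dots> \<le> ?C * (1 + L ^ (d - 1) + L ^ (d + 1) / m)"
      using C L by (intro mult_mono) auto
    finally show ?thesis .
  next
    case 3
    have r0: "r > 0" using 3 r by (cases "r = 0") (auto simp: inv_floor_def)
    define a where "a = 1 / r"
    have L1: "1 \<le> L" using 3 by (simp add: L_def)
    have a: "L \<le> a" "a \<le> L + 1"
      using le_inv_floor_iff[of "inv_floor m r" m r] le_inv_floor_iff[of "Suc (inv_floor m r)" m r] 3 r0
      by (auto simp: L_def a_def field_simps)
    have "p - L ^ d \<le> a ^ d - L ^ d" using p_le[OF r0] by (simp add: a_def)
    also have "\<dots> \<le> real d * a ^ (d - 1) * (a - L)" using a L by (intro power_diff_le)
    also have "\<dots> \<le> real d * (2 * L) ^ (d - 1) * 1"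
      using a L L1 by (intro mult_mono power_mono) auto
    also have "\<dots> = real d * 2 ^ (d - 1) * L ^ (d - 1)" by (simp add: power_mult_distrib)
    also have "\<dots> \<le> real d * 2 ^ d * L ^ (d - 1)"
      using L by (intro mult_right_mono mult_left_mono power_increasing[of "d - 1" d]) auto
    also have "\<dots> \<le> ?C * (1 + L ^ (d - 1) + L ^ (d + 1) / m)"
      using C L by (intro mult_mono) auto
    finally have upper: "p - L ^ d \<le> ?C * (1 + L ^ (d - 1) + L ^ (d + 1) / m)" .
    have "L ^ d - p \<le> a ^ d - p" using a L by (simp add: power_mono)
    also have "\<dots> \<le> 16 * real d / M * a ^ (d + 1)" using p_ge[OF r0] by (simp add: a_def)
    also have "\<dots> \<le> 16 * real d * (real d / m) * (2 * L) ^ (d + 1)"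
    proof -
      have "1 / M \<le> real d / m" using M M0 m by (simp add: field_simps)
      then have "16 * real d * (1 / M) * a ^ (d + 1) \<le> 16 * real d * (real d / m) * (2 * L) ^ (d + 1)"
        using a L L1 M0 by (intro mult_mono power_mono) auto
      then show ?thesis by simp
    qed
    also have "\<dots> = 16 * (real d)\<^sup>2 * 2 ^ (d + 1) * (L ^ (d + 1) / m)"
      unfolding power_mult_distrib by (simp add: power2_eq_square)
    also have "\<dots> \<le> ?C * (1 + L ^ (d - 1) + L ^ (d + 1) / m)"
      using C L by (intro mult_mono) auto
    finally show ?thesis using upper by linarith
  qed
qed

text \<open>The integral of \<open>L^(d + 1)\<close> grows like \<open>m\<close> at most but enters
  divided by \<open>m\<close>, and that of \<open>L^(d - 1)\<close> is bounded. Hence one constant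
  serves all \<open>m\<close>, \<open>M\<close> and \<open>x\<close>. The assumptions on
  \<open>P\<close> are those delivered by \<open>riesz_kernel_approx_poly\<close>.\<close>

lemma kernel_integral_asymptotics:
  assumes dim: "CARD('n::finite) = d + 1" and d: "d \<ge> 2"
  obtains C where "C > 0"
    "\<And>(x :: real ^ 'n) P M m. norm x = 1 \<Longrightarrow> m \<ge> 1 \<Longrightarrow> real m \<le> real d * M \<Longrightarrow> M \<le> 4 * real m \<Longrightarrow>
      (\<And>r. 0 \<le> r \<Longrightarrow> r \<le> 2 \<Longrightarrow> 0 \<le> poly P (r\<^sup>2 / 4) \<and> poly P (r\<^sup>2 / 4) \<le> (4 * M) ^ d) \<Longrightarrow>
      (\<And>r. 0 < r \<Longrightarrow> r \<le> 2 \<Longrightarrow> poly P (r\<^sup>2 / 4) \<le> (1 / r) ^ d) \<Longrightarrow>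
      (\<And>r. 0 < r \<Longrightarrow> r \<le> 2 \<Longrightarrow>
        (1 / r) ^ d - poly P (r\<^sup>2 / 4) \<le> 16 * real d / M * (1 / r) ^ (d + 1)) \<Longrightarrow>
      \<bar>(\<integral>y. poly P ((norm (x - y))\<^sup>2 / 4) \<partial>normalized_surface_measure) -
        real d * cap_constant d * (\<Sum>n = 1..m. 1 / real n)\<bar> \<le> C"
proof -
  define \<kappa> where "\<kappa> = cap_constant d"
  have \<kappa>: "\<kappa> > 0" unfolding \<kappa>_def by (rule cap_constant_pos)
  define C1 where "C1 = 16 ^ d + real d * 2 ^ d + 16 * (real d)\<^sup>2 * 2 ^ (d + 1)"
  define B where "B = \<kappa> * (1 + 2 ^ d)"
  define C2 where "C2 = 2 * (real d * \<kappa> * 2 ^ d + \<kappa> * (real d)\<^sup>2)"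
  have C1: "C1 > 0" unfolding C1_def by (intro add_pos_nonneg[OF add_pos_nonneg]) auto
  have B: "B > 0" using \<kappa> unfolding B_def by (intro mult_pos_pos add_pos_pos) auto
  have C2: "C2 \<ge> 0" using \<kappa> by (simp add: C2_def)
  show ?thesis
  proof (rule that[of "C1 * (1 + 2 * real d * B + real (d + 1) * B) + C2"])
    show "0 < C1 * (1 + 2 * real d * B + real (d + 1) * B) + C2"
      using C1 B C2 by (intro add_pos_nonneg mult_pos_pos) auto
  next
    fix x :: "real ^ 'n" and P and M :: real and m :: nat
    assume x: "norm x = 1" and m: "m \<ge> 1" and M: "real m \<le> real d * M" "M \<le> 4 * real m"
      and P: "\<And>r. 0 \<le> r \<Longrightarrow> r \<le> 2 \<Longrightarrow> 0 \<le> poly P (r\<^sup>2 / 4) \<and> poly P (r\<^sup>2 / 4) \<le> (4 * M) ^ d"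
        "\<And>r. 0 < r \<Longrightarrow> r \<le> 2 \<Longrightarrow> poly P (r\<^sup>2 / 4) \<le> (1 / r) ^ d"
        "\<And>r. 0 < r \<Longrightarrow> r \<le> 2 \<Longrightarrow>
          (1 / r) ^ d - poly P (r\<^sup>2 / 4) \<le> 16 * real d / M * (1 / r) ^ (d + 1)"
    define \<sigma> where "\<sigma> = (normalized_surface_measure :: (real ^ 'n) measure)"
    interpret finite_measure \<sigma>
      unfolding \<sigma>_def by (rule finite_measure_normalized_surface_measure)
    have space: "space \<sigma> = sphere 0 1" "measure \<sigma> (space \<sigma>) = 1"
      by (simp_all add: \<sigma>_def measure_normalized_surface_measure_space)
    define p where "p y = poly P ((norm (x - y))\<^sup>2 / 4)" for y
    define L where "L y = real (inv_floor m (norm (x - y)))" for y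
    have r2: "norm (x - y) \<le> 2" if "y \<in> space \<sigma>" for y
      using norm_triangle_ineq4[of x y] x that by (simp add: space)
    have p_int: "integrable \<sigma> p"
    proof (rule integrable_const_bound)
      show "AE y in \<sigma>. norm (p y) \<le> (4 * M) ^ d"
        using P(1) r2 by (intro AE_I2) (auto simp: p_def abs_le_iff intro: order_trans[of _ 0])
      have "sets \<sigma> = sets (restrict_space borel (sphere 0 1))" by (simp add: \<sigma>_def)
      moreover have "p \<in> borel_measurable borel"
        unfolding p_def by (intro borel_measurable_continuous_onI) (auto intro!: continuous_intros)
      ultimately show "p \<in> borel_measurable \<sigma>"
        by (metis measurable_cong_sets measurable_restrict_space1)
    qed
    have L_int: "integrable \<sigma> (\<lambda>y. L y ^ k)" if "k \<ge> 1" for k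
      unfolding L_def \<sigma>_def using that by (rule inv_floor_integral)
    have Ld: "integrable \<sigma> (\<lambda>y. L y ^ d)" "integrable \<sigma> (\<lambda>y. L y ^ (d - 1))" "integrable \<sigma> (\<lambda>y. L y ^ (d + 1))"
      by (rule L_int, use d in simp)+
    note LB = inv_floor_integral_bounds[OF dim d x, of m, folded \<sigma>_def \<kappa>_def, folded L_def B_def C2_def]
    have "\<bar>(\<integral>y. p y \<partial>\<sigma>) - (\<integral>y. L y ^ d \<partial>\<sigma>)\<bar> = \<bar>\<integral>y. p y - L y ^ d \<partial>\<sigma>\<bar>"
      using p_int Ld by simp
    also have "\<dots> \<le> (\<integral>y. \<bar>p y - L y ^ d\<bar> \<partial>\<sigma>)"
      by (rule integral_abs_bound)
    also have "\<dots> \<le> (\<integral>y. C1 * (1 + L y ^ (d - 1) + L y ^ (d + 1) / m) \<partial>\<sigma>)"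
    proof (rule Bochner_Integration.integral_mono)
      show "integrable \<sigma> (\<lambda>y. \<bar>p y - L y ^ d\<bar>)" using p_int Ld by auto
      show "integrable \<sigma> (\<lambda>y. C1 * (1 + L y ^ (d - 1) + L y ^ (d + 1) / m))" using Ld by auto
      fix y assume "y \<in> space \<sigma>"
      from r2[OF this] show "\<bar>p y - L y ^ d\<bar> \<le> C1 * (1 + L y ^ (d - 1) + L y ^ (d + 1) / m)"
        unfolding p_def L_def C1_def using P M m d by (intro kernel_inv_floor_diff[of _ M]) auto
    qed
    also have "\<dots> = C1 * (1 + (\<integral>y. L y ^ (d - 1) \<partial>\<sigma>) + (\<integral>y. L y ^ (d + 1) \<partial>\<sigma>) / m)"
      using Ld space by simp
    also have "\<dots> \<le> C1 * (1 + 2 * real d * B + real (d + 1) * B)"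
      using LB(1,2) C1 m by (intro mult_left_mono add_mono) (auto simp: field_simps)
    finally show "\<bar>(\<integral>y. poly P ((norm (x - y))\<^sup>2 / 4) \<partial>normalized_surface_measure) -
        real d * cap_constant d * (\<Sum>n = 1..m. 1 / real n)\<bar> \<le> C1 * (1 + 2 * real d * B + real (d + 1) * B) + C2"
      using LB(3) unfolding p_def \<sigma>_def[symmetric] \<kappa>_def[symmetric] by linarith
  qed
qed

section \<open>Energy of spherical designs\<close>

lemma same_order_power_pos:
  assumes "(\<lambda>t. real (N t)) \<asymp> (\<lambda>t. real t ^ d)" "t \<ge> 1"
  shows "N t > 0"
proof (rule ccontr)
  assume "\<not> N t > 0"
  then have "real t ^ d \<le> 0"
    using assms unfolding same_order_def by (metis mult_zero_right not_gr0 of_nat_0)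
  moreover have "0 < real t ^ d" using assms(2) by simp
  ultimately show False by linarith
qed

text \<open>With \<open>\<delta> = c N^(-1/d)\<close> from the separation,
  \<open>\<delta>^(-s)\<close> becomes a constant times \<open>N^(s/d)\<close>.\<close>

lemma well_separated_riesz_sum_le:
  fixes X :: "nat \<Rightarrow> (real ^ 'n) set"
  assumes dim: "CARD('n) = d + 1" and s: "real d < s" and sep: "well_separated d X"
  obtains C where "C > 0"
    "\<And>t x. t \<ge> 1 \<Longrightarrow> finite (X t) \<Longrightarrow> X t \<subseteq> sphere 0 1 \<Longrightarrow> x \<in> X t \<Longrightarrow>
      (\<Sum>y\<in>X t - {x}. norm (x - y) powr (- s)) \<le> C * real (card (X t)) powr (s / d)"
proof -
  obtain c where c: "c > 0" "\<And>t x y. t \<ge> 1 \<Longrightarrow> x \<in> X t \<Longrightarrow> y \<in> X t \<Longrightarrow> x \<noteq> y \<Longrightarrow>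
      norm (x - y) > c * real (card (X t)) powr (- 1 / real d)"
    using sep unfolding well_separated_def by blast
  obtain C where C: "C > 0"
    "\<And>(X :: (real ^ 'n) set) \<delta> x. finite X \<Longrightarrow> X \<subseteq> sphere 0 1 \<Longrightarrow> \<delta> > 0 \<Longrightarrow> x \<in> X \<Longrightarrow>
      (\<And>y z. y \<in> X \<Longrightarrow> z \<in> X \<Longrightarrow> y \<noteq> z \<Longrightarrow> norm (y - z) > \<delta>) \<Longrightarrow>
      (\<Sum>y\<in>X - {x}. norm (x - y) powr (- s)) \<le> C * \<delta> powr (- s)"
    using riesz_sum_separated_le[OF dim s] by blast
  show ?thesis
  proof (rule that[of "C * c powr (- s)"])
    show "C * c powr (- s) > 0" using C(1) c(1) by simp
    fix t x assume t: "t \<ge> 1" and X: "finite (X t)" "X t \<subseteq> sphere 0 1" and x: "x \<in> X t"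
    define N where "N = real (card (X t))"
    have N: "N > 0" using X(1) x by (auto simp: N_def card_gt_0_iff)
    have pos: "c * N powr (- 1 / real d) > 0" using c(1) N by simp
    have "(\<Sum>y\<in>X t - {x}. norm (x - y) powr (- s)) \<le> C * (c * N powr (- 1 / real d)) powr (- s)"
      using X x c(2)[OF t] pos by (intro C(2)) (auto simp: N_def)
    also have "(c * N powr (- 1 / real d)) powr (- s) = c powr (- s) * N powr (s / d)"
      using c(1) N by (simp add: powr_mult powr_powr)
    finally show "(\<Sum>y\<in>X t - {x}. norm (x - y) powr (- s)) \<le> C * c powr (- s) * N powr (s / d)"
      by (simp add: mult_ac)
  qed
qed

lemma riesz_energy_well_separated_le:
  fixes X :: "nat \<Rightarrow> (real ^ 'n) set"
  assumes dim: "CARD('n) = d + 1" and s: "real d < s" and sep: "well_separated d X"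
    and X: "\<And>t. t \<ge> 1 \<Longrightarrow> finite (X t) \<and> X t \<subseteq> sphere 0 1"
    and N: "\<And>t. t \<ge> 1 \<Longrightarrow> card (X t) = N t"
  shows "(\<lambda>t. riesz_energy s (X t)) \<lless> (\<lambda>t. real (N t) powr (1 + s / real d))"
proof -
  obtain C where C: "C > 0"
    "\<And>t x. t \<ge> 1 \<Longrightarrow> finite (X t) \<Longrightarrow> X t \<subseteq> sphere 0 1 \<Longrightarrow> x \<in> X t \<Longrightarrow>
      (\<Sum>y\<in>X t - {x}. norm (x - y) powr (- s)) \<le> C * real (card (X t)) powr (s / d)"
    using well_separated_riesz_sum_le[OF dim s sep] by blast
  show ?thesis
    unfolding dominated_def
  proof (intro exI conjI allI impI)
    show "C > 0" by fact
    fix t :: nat assume t: "1 \<le> t"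
    have "(\<Sum>x\<in>X t. \<Sum>y\<in>X t - {x}. norm (x - y) powr (- s)) \<le> (\<Sum>x\<in>X t. C * real (N t) powr (s / d))"
      using C(2)[OF t] X[OF t] N[OF t] by (intro sum_mono) auto
    also have "\<dots> = C * (real (N t) * real (N t) powr (s / d))" by (simp add: N[OF t])
    also have "real (N t) * real (N t) powr (s / d) = real (N t) powr (1 + s / d)"
      \<comment> \<open>When \<open>N t = 0\<close> both sides vanish, since \<open>0 powr\<close>
        any exponent is 0.\<close>
      by (cases "N t = 0") (auto simp: powr_add)
    finally have "2 * riesz_energy s (X t) \<le> C * real (N t) powr (1 + s / d)"
      by (simp add: riesz_energy_def)
    moreover have "0 \<le> C * real (N t) powr (1 + s / d)" using C(1) by simp
    ultimately show "riesz_energy s (X t) \<le> C * real (N t) powr (1 + s / d)" by linarith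
  qed
qed

lemma design_riesz_sum_asymptotics:
  fixes X :: "nat \<Rightarrow> (real ^ 'n) set"
  assumes dim: "CARD('n) = d + 1" and d: "d \<ge> 2"
    and design: "\<And>t. t \<ge> 1 \<Longrightarrow> spherical_design t (X t)"
    and card: "\<And>t. t \<ge> 1 \<Longrightarrow> card (X t) = N t"
    and sep: "well_separated d X"
    and N: "(\<lambda>t. real (N t)) \<asymp> (\<lambda>t. real t ^ d)"
  obtains C :: real where "C > 0"
    "\<And>t x. t \<ge> 2 \<Longrightarrow> x \<in> X t \<Longrightarrow>
      \<bar>(\<Sum>y\<in>X t - {x}. norm (x - y) powr (- real d)) -
        real d * cap_constant d * (\<Sum>n = 1..t div 2. 1 / real n) * N t\<bar> \<le> C * N t"
proof -
  obtain a b where ab: "a > 0" "b > 0" "\<And>t. t \<ge> 1 \<Longrightarrow> a * real (N t) \<le> real t ^ d"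
    "\<And>t. t \<ge> 1 \<Longrightarrow> real t ^ d \<le> b * real (N t)"
    using N unfolding same_order_def by blast
  have X: "finite (X t)" "X t \<subseteq> sphere 0 1" if "t \<ge> 1" for t
    using design[OF that] unfolding spherical_design_def by auto
  obtain C where C: "C > 0"
    "\<And>t x. t \<ge> 1 \<Longrightarrow> finite (X t) \<Longrightarrow> X t \<subseteq> sphere 0 1 \<Longrightarrow> x \<in> X t \<Longrightarrow>
      (\<Sum>y\<in>X t - {x}. norm (x - y) powr (- real (d + 1))) \<le> C * real (card (X t)) powr (real (d + 1) / d)"
    using well_separated_riesz_sum_le[OF dim _ sep, of "real (d + 1)"] by (metis less_add_one of_nat_less_iff)
  obtain D where D: "D > 0"
    "\<And>(x :: real ^ 'n) P M m. norm x = 1 \<Longrightarrow> m \<ge> 1 \<Longrightarrow> real m \<le> real d * M \<Longrightarrow> M \<le> 4 * real m \<Longrightarrow>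
      (\<And>r. 0 \<le> r \<Longrightarrow> r \<le> 2 \<Longrightarrow> 0 \<le> poly P (r\<^sup>2 / 4) \<and> poly P (r\<^sup>2 / 4) \<le> (4 * M) ^ d) \<Longrightarrow>
      (\<And>r. 0 < r \<Longrightarrow> r \<le> 2 \<Longrightarrow> poly P (r\<^sup>2 / 4) \<le> (1 / r) ^ d) \<Longrightarrow>
      (\<And>r. 0 < r \<Longrightarrow> r \<le> 2 \<Longrightarrow>
        (1 / r) ^ d - poly P (r\<^sup>2 / 4) \<le> 16 * real d / M * (1 / r) ^ (d + 1)) \<Longrightarrow>
      \<bar>(\<integral>y. poly P ((norm (x - y))\<^sup>2 / 4) \<partial>normalized_surface_measure) -
        real d * cap_constant d * (\<Sum>n = 1..m. 1 / real n)\<bar> \<le> D"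
    using kernel_integral_asymptotics[OF dim d] by blast
  define E where "E = 32 * (real d)\<^sup>2 * C * (1 / a) powr (1 / d)"
  show ?thesis
  proof (rule that[of "D + 8 ^ d * b + E"])
    show "D + 8 ^ d * b + E > 0"
      using D(1) ab C(1) by (auto simp: E_def intro!: add_pos_nonneg)
    fix t x assume t: "t \<ge> 2" and x: "x \<in> X t"
    then have t1: "t \<ge> 1" by simp
    define m where "m = t div 2"
    \<comment> \<open>The largest \<open>j\<close> for which the degree bound \<open>2 j d\<close>
      stays within \<open>t\<close>. For \<open>t < 2 d\<close> it is 0 and \<open>P\<close> is
      constant, but \<open>M = 1\<close> still satisfies the comparisons with \<open>t\<close> and
      \<open>m\<close> below.\<close>
    define j where "j = t div (2 * d)"
    define M where "M = 2 * real j + 1"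
    define H where "H = (\<Sum>n = 1..m. 1 / real n)"
    have Npos: "N t > 0" using same_order_power_pos[OF N t1] .
    have nx: "norm x = 1" using X(2)[OF t1] x by auto
    have m: "m \<ge> 1" "2 * m \<le> t" "t \<le> 2 * m + 1" using t by (auto simp: m_def)
    have jd: "2 * j * d \<le> t"
      using div_times_less_eq_dividend[of t "2 * d"] by (simp add: j_def mult_ac)
    have "t < 2 * d * (j + 1)"
      using dividend_less_div_times[of "2 * d" t] d by (simp add: j_def algebra_simps)
    then have "real t < real (2 * d * (j + 1))" by (simp only: of_nat_less_iff)
    also have "\<dots> \<le> 2 * real d * M" by (simp add: M_def algebra_simps)
    finally have tM: "real t \<le> 2 * real d * M" by simp
    have M1: "M \<ge> 1" by (simp add: M_def)
    have mM: "real m \<le> real d * M" using tM m(2) by simp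
    have "2 * j \<le> t" using jd d by (metis le_trans mult.right_neutral mult_le_mono2 one_le_numeral)
    then have M4: "M \<le> 4 * real m" using m by (simp add: M_def)
    obtain P :: "real poly" where P: "degree P \<le> 2 * j * d"
      "\<And>r. 0 \<le> r \<Longrightarrow> r \<le> 2 \<Longrightarrow> 0 \<le> poly P (r\<^sup>2 / 4) \<and> poly P (r\<^sup>2 / 4) \<le> (4 * M) ^ d"
      "\<And>r. 0 < r \<Longrightarrow> r \<le> 2 \<Longrightarrow> poly P (r\<^sup>2 / 4) \<le> (1 / r) ^ d"
      "\<And>r. 0 < r \<Longrightarrow> r \<le> 2 \<Longrightarrow>
        (1 / r) ^ d - poly P (r\<^sup>2 / 4) \<le> 16 * real d / M * (1 / r) ^ (d + 1)"
      using riesz_kernel_approx_poly[of d j] d unfolding M_def by (metis One_nat_def Suc_1 Suc_leD)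
    define p where "p y = poly P ((norm (x - y))\<^sup>2 / 4)" for y
    have "spherical_polynomial t p"
      unfolding p_def using P(1) jd nx by (intro spherical_polynomial_poly_dist) auto
    then have "1 / real (N t) * (\<Sum>y\<in>X t. p y) = (\<integral>y. p y \<partial>normalized_surface_measure)"
      using design[OF t1] card[OF t1] unfolding spherical_design_def by auto
    moreover have "\<bar>(\<integral>y. p y \<partial>normalized_surface_measure) - real d * cap_constant d * H\<bar> \<le> D"
      unfolding p_def H_def using nx m mM M4 P by (intro D(2)[of _ _ M]) auto
    ultimately have "\<bar>1 / real (N t) * (\<Sum>y\<in>X t. p y) - real d * cap_constant d * H\<bar> \<le> D" by simp
    then have "real (N t) * \<bar>1 / real (N t) * (\<Sum>y\<in>X t. p y) - real d * cap_constant d * H\<bar> \<le> real (N t) * D"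
      by (intro mult_left_mono) auto
    also have "real (N t) * \<bar>1 / real (N t) * (\<Sum>y\<in>X t. p y) - real d * cap_constant d * H\<bar> =
        \<bar>real (N t) * (1 / real (N t) * (\<Sum>y\<in>X t. p y) - real d * cap_constant d * H)\<bar>"
      by (simp add: abs_mult)
    also have "real (N t) * (1 / real (N t) * (\<Sum>y\<in>X t. p y) - real d * cap_constant d * H) =
        (\<Sum>y\<in>X t. p y) - real d * cap_constant d * H * N t"
      using Npos by (simp add: field_simps)
    finally have sum_p: "\<bar>(\<Sum>y\<in>X t. p y) - real d * cap_constant d * H * N t\<bar> \<le> D * N t"
      by (simp add: mult.commute)
    have p_x: "0 \<le> p x" "p x \<le> 8 ^ d * b * N t"
    proof -
      show "0 \<le> p x" using P(2)[of 0] by (simp add: p_def)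
      have "p x \<le> (4 * M) ^ d" using P(2)[of 0] by (simp add: p_def)
      also have "\<dots> \<le> (8 * real t) ^ d"
      proof -
        have "M \<le> 2 * real t" using M4 m(2) by simp
        then show ?thesis using M1 by (intro power_mono) auto
      qed
      also have "\<dots> = 8 ^ d * real t ^ d" by (simp add: power_mult_distrib)
      also have "\<dots> \<le> 8 ^ d * (b * N t)" using ab(4)[OF t1] by (intro mult_left_mono) auto
      finally show "p x \<le> 8 ^ d * b * N t" by (simp add: mult_ac)
    qed
    have r: "0 < norm (x - y) \<and> norm (x - y) \<le> 2" if "y \<in> X t - {x}" for y
      using norm_triangle_ineq4[of x y] nx that X(2)[OF t1] by auto
    have powr: "norm (x - y) powr (- real k) = (1 / norm (x - y)) ^ k" if "y \<in> X t - {x}" for y k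
      using r[OF that] by (simp add: powr_minus powr_realpow power_inverse divide_inverse)
    define S where "S = (\<Sum>y\<in>X t - {x}. norm (x - y) powr (- real d))"
    have diff_ge: "0 \<le> S - (\<Sum>y\<in>X t - {x}. p y)"
      unfolding S_def sum_subtractf[symmetric]
    proof (rule sum_nonneg)
      fix y assume y: "y \<in> X t - {x}"
      show "0 \<le> norm (x - y) powr (- real d) - p y"
        using P(3)[of "norm (x - y)"] r[OF y] unfolding powr[OF y] p_def by simp
    qed
    have "S - (\<Sum>y\<in>X t - {x}. p y) \<le>
        (\<Sum>y\<in>X t - {x}. 16 * real d / M * norm (x - y) powr (- real (d + 1)))"
      unfolding S_def sum_subtractf[symmetric]
    proof (rule sum_mono)
      fix y assume y: "y \<in> X t - {x}"
      show "norm (x - y) powr (- real d) - p y \<le> 16 * real d / M * norm (x - y) powr (- real (d + 1))"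
        using P(4)[of "norm (x - y)"] r[OF y] unfolding powr[OF y] p_def by simp
    qed
    also have "\<dots> = 16 * real d / M * (\<Sum>y\<in>X t - {x}. norm (x - y) powr (- real (d + 1)))"
      by (simp only: sum_distrib_left)
    also have "\<dots> \<le> 16 * real d / M * (C * real (N t) powr (real (d + 1) / d))"
      using C(2)[OF t1 X[OF t1] x] M1 card[OF t1] by (intro mult_left_mono) auto
    also have "real (N t) powr (real (d + 1) / d) = N t * real (N t) powr (1 / d)"
      using Npos d by (simp add: add_divide_distrib powr_add)
    \<comment> \<open>\<open>N^(1/d)\<close> is at most a constant times \<open>t\<close>, hence at
      most a constant times \<open>M\<close>, and cancels the \<open>1 / M\<close>. What is left is
      \<open>E\<close>.\<close>
    also have "16 * real d / M * (C * (N t * real (N t) powr (1 / d))) \<le>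
        16 * real d / M * (C * (N t * ((1 / a) powr (1 / d) * (2 * real d * M))))"
    proof -
      have "real (N t) \<le> 1 / a * real t ^ d" using ab(3)[OF t1] ab(1) by (simp add: field_simps)
      then have "real (N t) powr (1 / d) \<le> (1 / a * real t ^ d) powr (1 / d)"
        by (intro powr_mono2) auto
      also have "\<dots> = (1 / a) powr (1 / d) * (real t powr real d) powr (1 / d)"
        using powr_mult[of "1 / a" "real t ^ d" "1 / d"] ab(1) t by (simp add: powr_realpow)
      also have "\<dots> = (1 / a) powr (1 / d) * real t" using t d by (simp add: powr_powr)
      also have "\<dots> \<le> (1 / a) powr (1 / d) * (2 * real d * M)" using tM by (intro mult_left_mono) auto
      finally show ?thesis using M1 C(1) by (intro mult_left_mono) auto
    qed
    also have "\<dots> = E * N t" using M1 by (simp add: E_def power2_eq_square)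
    finally have diff_le: "S - (\<Sum>y\<in>X t - {x}. p y) \<le> E * N t" .
    have "(\<Sum>y\<in>X t. p y) = p x + (\<Sum>y\<in>X t - {x}. p y)"
      using X(1)[OF t1] x by (rule sum.remove)
    moreover have "0 \<le> E * N t" "0 \<le> 8 ^ d * b * N t"
      using C(1) ab by (auto simp: E_def)
    ultimately have "\<bar>S - real d * cap_constant d * H * N t\<bar> \<le> D * N t + 8 ^ d * b * N t + E * N t"
      using sum_p p_x diff_ge diff_le by linarith
    then show "\<bar>S - real d * cap_constant d * (\<Sum>n = 1..t div 2. 1 / real n) * N t\<bar> \<le>
        (D + 8 ^ d * b + E) * N t"
      by (simp add: H_def m_def algebra_simps)
  qed
qed

text \<open>The harmonic number of \<open>m\<close> lies between \<open>ln (m + 1)\<close> and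
  \<open>1 + ln m\<close>. Replacing \<open>t\<close> by its half costs \<open>ln 2\<close>, which
  is less than 1.\<close>

lemma harmonic_half_ln_bounded:
  assumes "t \<ge> (2 :: nat)"
  shows "\<bar>(\<Sum>n = 1..t div 2. 1 / real n) - ln (real t)\<bar> \<le> 1"
proof -
  define m where "m = t div 2"
  have m: "m \<ge> 1" "2 * m \<le> t" "t \<le> 2 * (m + 1)" using assms by (auto simp: m_def)
  have H: "(\<Sum>n = 1..m. 1 / real n) = harm m" by (simp add: harm_def inverse_eq_divide)
  have "ln (real t) \<le> ln (2 * (real m + 1))"
    using m assms by (subst ln_le_cancel_iff) auto
  also have "\<dots> = ln 2 + ln (real m + 1)" by (rule ln_mult_pos) auto
  also have "\<dots> \<le> 1 + harm m" using ln_le_harm[of m] ln_2_less_1 by linarith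
  finally have "ln (real t) \<le> 1 + harm m" .
  moreover have "harm m \<le> ln (real m) + 1" using euler_mascheroni_sequence_decreasing[of 1 m] m by (simp add: harm_def)
  moreover have "ln (real m) \<le> ln (real t)" using m by simp
  ultimately show ?thesis unfolding m_def[symmetric] H by linarith
qed

theorem theorem2:
  fixes d :: nat
    and N :: "nat \<Rightarrow> nat"
    and X :: "nat \<Rightarrow> (real ^ 'n) set"
  assumes "CARD('n) = d + 1"
    and "d \<ge> 2"
    and "\<And>t. t \<ge> 1 \<Longrightarrow> spherical_design t (X t)"
    and "\<And>t. t \<ge> 1 \<Longrightarrow> card (X t) = N t"
    and "well_separated d X"
    and "(\<lambda>t. real (N t)) \<asymp> (\<lambda>t. real t ^ d)"
  shows "(\<forall>s. s > real d \<longrightarrow>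
      (\<lambda>t. riesz_energy s (X t)) \<lless> (\<lambda>t. real (N t) powr (1 + s / real d))) \<and>
    (\<lambda>t. riesz_energy (real d) (X t) -
        1 / (2 * sqrt pi) * (Gamma (real d / 2 + 1 / 2) / Gamma (real d / 2)) *
          (\<Sum>n = 1..t div 2. 1 / real n) * real (N t) ^ 2)
      \<in> O(\<lambda>t. real (N t) ^ 2) \<and>
    (\<lambda>t. riesz_energy (real d) (X t) / (real (N t) ^ 2 * ln (real (N t))))
      \<longlonglongrightarrow> 1 / (2 * real d * sqrt pi) * (Gamma (real d / 2 + 1 / 2) / Gamma (real d / 2))"
proof -
  define K where "K = real d * cap_constant d / 2"
  define H where "H t = (\<Sum>n = 1..t div 2. 1 / real n)" for t :: nat
  define E where "E t = riesz_energy (real d) (X t)" for t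
  have K: "K = 1 / (2 * sqrt pi) * (Gamma (real d / 2 + 1 / 2) / Gamma (real d / 2))"
    using cap_constant_altdef[of d] assms(2) by (simp add: K_def)
  obtain C :: real where C: "C > 0"
    "\<And>t x. t \<ge> 2 \<Longrightarrow> x \<in> X t \<Longrightarrow>
      \<bar>(\<Sum>y\<in>X t - {x}. norm (x - y) powr (- real d)) - real d * cap_constant d * H t * N t\<bar> \<le> C * N t"
    using design_riesz_sum_asymptotics[OF assms] unfolding H_def by blast
  have energy: "\<bar>E t - K * H t * (real (N t))\<^sup>2\<bar> \<le> C * (real (N t))\<^sup>2" if t: "t \<ge> 2" for t
  proof -
    define S where "S x = (\<Sum>y\<in>X t - {x}. norm (x - y) powr (- real d))" for x
    have "E t - K * H t * (real (N t))\<^sup>2 =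
        1 / 2 * (\<Sum>x\<in>X t. S x - real d * cap_constant d * H t * N t)"
      using assms(4)[of t] t
      by (simp add: E_def riesz_energy_def S_def sum_subtractf K_def power2_eq_square field_simps)
    also have "\<bar>\<dots>\<bar> \<le> 1 / 2 * (\<Sum>x\<in>X t. C * N t)"
      unfolding abs_mult S_def using C(2)[OF t]
      by (intro mult_mono order_trans[OF sum_abs] sum_mono) auto
    also have "\<dots> = 1 / 2 * (C * (real (N t))\<^sup>2)"
      using assms(4)[of t] t by (simp add: power2_eq_square)
    also have "\<dots> \<le> C * (real (N t))\<^sup>2" using C(1) by simp
    finally show ?thesis .
  qed
  obtain a b where ab: "a > 0" "b > 0" "\<And>t. t \<ge> 1 \<Longrightarrow> a * real (N t) \<le> real t ^ d"
    "\<And>t. t \<ge> 1 \<Longrightarrow> real t ^ d \<le> b * real (N t)"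
    using assms(6) unfolding same_order_def by blast
  have lnN: "\<bar>ln (real (N t)) - real d * ln (real t)\<bar> \<le> \<bar>ln a\<bar> + \<bar>ln b\<bar>" if t: "t \<ge> 1" for t
  proof -
    have N: "real (N t) > 0" using same_order_power_pos[OF assms(6) t] by simp
    have "ln (a * real (N t)) \<le> ln (real t ^ d)" "ln (real t ^ d) \<le> ln (b * real (N t))"
      using ab t N by (auto simp: ln_le_cancel_iff)
    then have "ln a + ln (real (N t)) \<le> real d * ln (real t)" "real d * ln (real t) \<le> ln b + ln (real (N t))"
      using ab(1,2) t N by (simp_all add: ln_mult ln_realpow)
    then show ?thesis by linarith
  qed
  have lnN_top: "filterlim (\<lambda>t. ln (real (N t))) at_top sequentially"
  proof (rule filterlim_at_top_mono)
    show "filterlim (\<lambda>t. real d * ln (real t) - (\<bar>ln a\<bar> + \<bar>ln b\<bar>)) at_top sequentially"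
      using assms(2) by real_asymp
    show "\<forall>\<^sub>F t in sequentially. real d * ln (real t) - (\<bar>ln a\<bar> + \<bar>ln b\<bar>) \<le> ln (real (N t))"
      using eventually_ge_at_top[of 1]
    proof eventually_elim
      case (elim t)
      then show ?case using lnN[of t] by linarith
    qed
  qed
  define B where "B = C + \<bar>K\<bar> * (1 + (\<bar>ln a\<bar> + \<bar>ln b\<bar>))"
  have "((\<lambda>t. E t / ((real (N t))\<^sup>2 * ln (real (N t))) - K / d) \<longlongrightarrow> 0) sequentially"
  proof (rule Lim_null_comparison)
    show "(\<lambda>t. B / ln (real (N t))) \<longlonglongrightarrow> 0"
      using lnN_top by (intro tendsto_divide_0[OF tendsto_const] filterlim_at_top_imp_at_infinity)
    show "\<forall>\<^sub>F t in sequentially.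
        norm (E t / ((real (N t))\<^sup>2 * ln (real (N t))) - K / d) \<le> B / ln (real (N t))"
      using eventually_ge_at_top[of 2] filterlim_at_top_dense[THEN iffD1, OF lnN_top, rule_format, of 0]
    proof eventually_elim
      case (elim t)
      define n where "n = real (N t)"
      define l where "l = ln n"
      have l: "l > 0" using elim by (simp add: l_def n_def)
      have n: "n > 0" using same_order_power_pos[OF assms(6), of t] elim by (simp add: n_def)
      have dpos: "real d \<ge> 1" using assms(2) by simp
      \<comment> \<open>The harmonic sum is \<open>ln t\<close> up to a constant, while
        \<open>l = ln N\<close> is \<open>d * ln t\<close> up to a constant; the extra
        \<open>1 / d\<close> in the limit comes from here.\<close>
      have Hl: "\<bar>H t - l / d\<bar> \<le> 1 + (\<bar>ln a\<bar> + \<bar>ln b\<bar>)"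
      proof -
        have "l / d - ln (real t) = (l - real d * ln (real t)) / d"
          using dpos by (simp add: field_simps)
        then have "\<bar>ln (real t) - l / d\<bar> = \<bar>l - real d * ln (real t)\<bar> / d"
          by (simp add: abs_minus_commute[of "ln (real t)"])
        also have "\<dots> \<le> \<bar>l - real d * ln (real t)\<bar> / 1" using dpos by (intro divide_left_mono) auto
        also have "\<dots> \<le> \<bar>ln a\<bar> + \<bar>ln b\<bar>" using lnN[of t] elim by (simp add: l_def n_def)
        finally show ?thesis using harmonic_half_ln_bounded[of t] elim unfolding H_def by linarith
      qed
      \<comment> \<open>The numerator consists of the bounded error of the energy asymptotics and
        the bounded error of replacing \<open>H t\<close> by \<open>l / d\<close>; \<open>B\<close>
        bounds their sum, and \<open>l\<close> tends to infinity.\<close>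
      have "E t / (n\<^sup>2 * l) - K / d = ((E t - K * H t * n\<^sup>2) / n\<^sup>2 + K * (H t - l / d)) / l"
        using n l dpos by (simp add: field_simps)
      also have "\<bar>\<dots>\<bar> = \<bar>(E t - K * H t * n\<^sup>2) / n\<^sup>2 + K * (H t - l / d)\<bar> / l"
        using l by simp
      also have "\<dots> \<le> (\<bar>E t - K * H t * n\<^sup>2\<bar> / n\<^sup>2 + \<bar>K\<bar> * \<bar>H t - l / d\<bar>) / l"
        using l n by (intro divide_right_mono order_trans[OF abs_triangle_ineq]) (auto simp: abs_mult)
      also have "\<dots> \<le> (C * n\<^sup>2 / n\<^sup>2 + \<bar>K\<bar> * (1 + (\<bar>ln a\<bar> + \<bar>ln b\<bar>))) / l"
        using energy[of t] Hl l elim unfolding n_def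
        by (intro divide_right_mono add_mono mult_left_mono) auto
      also have "\<dots> = B / l" using n by (simp add: B_def)
      finally show ?case by (simp add: l_def n_def)
    qed
  qed
  then have lim: "(\<lambda>t. E t / ((real (N t))\<^sup>2 * ln (real (N t)))) \<longlonglongrightarrow> K / d"
    by (rule LIM_zero_cancel)
  have Kd: "K / d = 1 / (2 * real d * sqrt pi) * (Gamma (real d / 2 + 1 / 2) / Gamma (real d / 2))"
    by (simp add: K)
  have bigo: "(\<lambda>t. E t - K * H t * (real (N t))\<^sup>2) \<in> O(\<lambda>t. (real (N t))\<^sup>2)"
  proof (rule bigoI)
    show "\<forall>\<^sub>F t in sequentially. norm (E t - K * H t * (real (N t))\<^sup>2) \<le> C * norm ((real (N t))\<^sup>2)"
      using eventually_ge_at_top[of 2] by eventually_elim (use energy in simp)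
  qed
  have "(\<lambda>t. riesz_energy s (X t)) \<lless> (\<lambda>t. real (N t) powr (1 + s / real d))" if "s > real d" for s
    using assms that by (intro riesz_energy_well_separated_le) (auto simp: spherical_design_def)
  then show ?thesis
    using lim[unfolded Kd E_def] bigo[unfolded E_def H_def K] by blast
qed

end
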